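(* Let $\mathcal H$ be a CNP space and let $h$ be a densely defined multiplier of $\mathcal H$, with $T$ the operator of multiplication by $h$. The closed $*$-invariant subspaces of $\mathrm{Dom}\,T^*=\mathcal H(B)$ are the intersections of $\mathcal H(B)$ with the closed $*$-invariant subspaces of $\mathcal H$. Precisely, if $\mathcal J$ is a closed (in the $\mathcal H(B)$ norm) $*$-invariant subspace of $\mathcal H(B)$ and $\mathcal K$ is the closure of $\mathcal J$ in $\mathcal H$, then $\mathcal J=\mathcal K\cap\mathcal H(B)$. In particular, if $\mathcal J'\subseteq\mathcal H(B)$ is a $*$-invariant linear subspace, not necessarily closed, and $\mathcal K'$ is the image of $\mathcal J'$ under the embedding $\mathcal H(B)\subset\mathcal H$, then $\mathcal K'$ is dense in $\mathcal H$ if and only if $\mathcal J'$ is dense in $\mathcal H(B)$, i.e. if and only if $\mathcal J'$ is a core for $T^*$.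
   Context: A CNP kernel on a set $X$ is a kernel of the form $k(x,y)=\frac{1}{1-\langle u(x),u(y)\rangle}$ where $u:X\to \ell^2(I)$ is injective and $\|u(x)\|<1$ for all $x$. A CNP space on $X$ is the reproducing kernel Hilbert space $\mathcal H$ on $X$ with such a kernel. $\mathrm{Mult}(\mathcal H)$ is the algebra of functions $\varphi:X\to\mathbb C$ with $\varphi\mathcal H\subset\mathcal H$; $M_\varphi f=\varphi f$, with adjoint $M_\varphi^*$ on $\mathcal H$. A densely defined multiplier of $\mathcal H$ is a function $h:X\to\mathbb C$ for which $\mathrm{Dom}\,T=\{f\in\mathcal H: hf\in\mathcal H\}$ is dense in $\mathcal H$; $Tf=hf$ is then a closed densely defined operator, with densely defined closed adjoint $T^*$. $\mathcal H(B)$ denotes $\mathrm{Dom}\,T^*$ equipped with the graph norm $\|f\|_{\mathcal H(B)}^2=\|f\|_{\mathcal H}^2+\|T^*f\|_{\mathcal H}^2$; it is a Hilbert space contractively contained in $\mathcal H$ and is mapped into itself by every $M_\varphi^*$. A linear subspace $\mathcal J$ of $\mathcal H(B)$ (or of $\mathcal H$) is $*$-invariant if $M_\varphi^*\mathcal J\subset\mathcal J$ for all $\varphi\in\mathrm{Mult}(\mathcal H)$. A core for a closed operator is a linear subspace of its domain that is dense in the domain for the graph norm. *)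

theory Defs
  imports "HOL-Analysis.Analysis" "HOL-Library.Function_Algebras"
begin

text \<open>
  The set \<open>X\<close> is the type \<open>'x\<close>, and complex functions on \<open>X\<close> form an algebra under the
  pointwise operations of \<open>Function_Algebras\<close>; in particular \<open>h * f\<close> is the pointwise product.
\<close>

definition cscale :: "complex \<Rightarrow> ('x \<Rightarrow> complex) \<Rightarrow> 'x \<Rightarrow> complex"
  where "cscale c f = (\<lambda>x. c * f x)"

global_interpretation cfun: vector_space "cscale :: complex \<Rightarrow> ('x \<Rightarrow> complex) \<Rightarrow> _"
  by standard (auto simp: cscale_def fun_eq_iff algebra_simps)

text \<open>
  A space of functions is given by its carrier \<open>V\<close> together with a norm \<open>N\<close> that is only
  meaningful on \<open>V\<close>. The distance is set to \<open>0\<close> off the carrier because \<^locale>\<open>Metric_space\<close>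
  requires symmetry and nonnegativity on the whole type.
\<close>

definition norm_dist ::
    "('x \<Rightarrow> complex) set \<Rightarrow> (('x \<Rightarrow> complex) \<Rightarrow> real) \<Rightarrow> ('x \<Rightarrow> complex) \<Rightarrow> ('x \<Rightarrow> complex) \<Rightarrow> real"
  where "norm_dist V N f g = (if f \<in> V \<and> g \<in> V then N (f - g) else 0)"

definition norm_topology ::
    "('x \<Rightarrow> complex) set \<Rightarrow> (('x \<Rightarrow> complex) \<Rightarrow> real) \<Rightarrow> ('x \<Rightarrow> complex) topology"
  where "norm_topology V N = Metric_space.mtopology V (norm_dist V N)"

definition norm_dense ::
    "('x \<Rightarrow> complex) set \<Rightarrow> (('x \<Rightarrow> complex) \<Rightarrow> real) \<Rightarrow> ('x \<Rightarrow> complex) set \<Rightarrow> bool"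
  where "norm_dense V N S \<longleftrightarrow> S \<subseteq> V \<and> norm_topology V N closure_of S = V"

type_synonym 'x cinner = "('x \<Rightarrow> complex) \<Rightarrow> ('x \<Rightarrow> complex) \<Rightarrow> complex"

definition ip_norm :: "'x cinner \<Rightarrow> ('x \<Rightarrow> complex) \<Rightarrow> real"
  where "ip_norm ip f = sqrt (Re (ip f f))"

text \<open>The inner product is linear in its first argument.\<close>

locale hilbert_function_space =
  fixes H :: "('x \<Rightarrow> complex) set" and ip :: "'x cinner"
  assumes subspace: "cfun.subspace H"
    and ip_add: "\<lbrakk>f \<in> H; g \<in> H; w \<in> H\<rbrakk> \<Longrightarrow> ip (f + g) w = ip f w + ip g w"
    and ip_scale: "\<lbrakk>f \<in> H; w \<in> H\<rbrakk> \<Longrightarrow> ip (cscale c f) w = c * ip f w"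
    and ip_cnj: "\<lbrakk>f \<in> H; g \<in> H\<rbrakk> \<Longrightarrow> ip g f = cnj (ip f g)"
    and ip_pos: "\<lbrakk>f \<in> H; f \<noteq> 0\<rbrakk> \<Longrightarrow> 0 < Re (ip f f)"
    and complete: "Metric_space.mcomplete H (norm_dist H (ip_norm ip))"

locale rkhs = hilbert_function_space H ip
  for H :: "('x \<Rightarrow> complex) set" and ip :: "'x cinner" +
  fixes k :: "'x \<Rightarrow> 'x \<Rightarrow> complex"
  assumes kernel_mem: "(\<lambda>x. k x y) \<in> H"
    and reproducing: "f \<in> H \<Longrightarrow> f y = ip f (\<lambda>x. k x y)"

text \<open>\<open>\<ell>\<^sup>2(I)\<close>, where the index set \<open>I\<close> is the type \<open>'i\<close>.\<close>

definition ell2 :: "('i \<Rightarrow> complex) set"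
  where "ell2 = {a. (\<lambda>i. (cmod (a i))\<^sup>2) summable_on UNIV}"

definition ell2_inner :: "('i \<Rightarrow> complex) \<Rightarrow> ('i \<Rightarrow> complex) \<Rightarrow> complex"
  where "ell2_inner a b = (\<Sum>\<^sub>\<infinity>i. a i * cnj (b i))"

definition ell2_norm :: "('i \<Rightarrow> complex) \<Rightarrow> real"
  where "ell2_norm a = sqrt (\<Sum>\<^sub>\<infinity>i. (cmod (a i))\<^sup>2)"

text \<open>
  The map \<open>u\<close> is kept as a parameter, since its index type cannot be quantified
  existentially inside the definition.
\<close>

definition cnp_kernel :: "('x \<Rightarrow> 'i \<Rightarrow> complex) \<Rightarrow> ('x \<Rightarrow> 'x \<Rightarrow> complex) \<Rightarrow> bool"
  where "cnp_kernel u k \<longleftrightarrow>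
    inj u \<and> (\<forall>x. u x \<in> ell2 \<and> ell2_norm (u x) < 1) \<and>
    (\<forall>x y. k x y = 1 / (1 - ell2_inner (u x) (u y)))"

definition cnp_space ::
    "('x \<Rightarrow> 'i \<Rightarrow> complex) \<Rightarrow> ('x \<Rightarrow> 'x \<Rightarrow> complex) \<Rightarrow> ('x \<Rightarrow> complex) set \<Rightarrow> 'x cinner \<Rightarrow> bool"
  where "cnp_space u k H ip \<longleftrightarrow> cnp_kernel u k \<and> rkhs H ip k"

text \<open>
  The adjoint of an operator \<open>A\<close> with domain \<open>D\<close>; the description operator below picks out a
  unique element when \<open>D\<close> is dense in \<open>H\<close> and \<open>g\<close> lies in the domain of the adjoint.
\<close>

definition adj_dom ::
    "('x \<Rightarrow> complex) set \<Rightarrow> 'x cinner \<Rightarrow> ('x \<Rightarrow> complex) set \<Rightarrow>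
     (('x \<Rightarrow> complex) \<Rightarrow> 'x \<Rightarrow> complex) \<Rightarrow> ('x \<Rightarrow> complex) set"
  where "adj_dom H ip D A = {g \<in> H. \<exists>w\<in>H. \<forall>f\<in>D. ip (A f) g = ip f w}"

definition adj ::
    "('x \<Rightarrow> complex) set \<Rightarrow> 'x cinner \<Rightarrow> ('x \<Rightarrow> complex) set \<Rightarrow>
     (('x \<Rightarrow> complex) \<Rightarrow> 'x \<Rightarrow> complex) \<Rightarrow> ('x \<Rightarrow> complex) \<Rightarrow> 'x \<Rightarrow> complex"
  where "adj H ip D A g = (THE w. w \<in> H \<and> (\<forall>f\<in>D. ip (A f) g = ip f w))"

definition graph_norm ::
    "'x cinner \<Rightarrow> (('x \<Rightarrow> complex) \<Rightarrow> 'x \<Rightarrow> complex) \<Rightarrow> ('x \<Rightarrow> complex) \<Rightarrow> real"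
  where "graph_norm ip A f = sqrt ((ip_norm ip f)\<^sup>2 + (ip_norm ip (A f))\<^sup>2)"

definition is_core ::
    "'x cinner \<Rightarrow> ('x \<Rightarrow> complex) set \<Rightarrow> (('x \<Rightarrow> complex) \<Rightarrow> 'x \<Rightarrow> complex) \<Rightarrow>
     ('x \<Rightarrow> complex) set \<Rightarrow> bool"
  where "is_core ip D A J \<longleftrightarrow> cfun.subspace J \<and> J \<subseteq> D \<and> norm_dense D (graph_norm ip A) J"

definition Mult :: "('x \<Rightarrow> complex) set \<Rightarrow> ('x \<Rightarrow> complex) set"
  where "Mult H = {\<phi>. \<forall>f\<in>H. \<phi> * f \<in> H}"

definition Mult_adj ::
    "('x \<Rightarrow> complex) set \<Rightarrow> 'x cinner \<Rightarrow> ('x \<Rightarrow> complex) \<Rightarrow> ('x \<Rightarrow> complex) \<Rightarrow> 'x \<Rightarrow> complex"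
  where "Mult_adj H ip \<phi> = adj H ip H (\<lambda>f. \<phi> * f)"

definition star_invariant ::
    "('x \<Rightarrow> complex) set \<Rightarrow> 'x cinner \<Rightarrow> ('x \<Rightarrow> complex) set \<Rightarrow> bool"
  where "star_invariant H ip J \<longleftrightarrow> (\<forall>\<phi>\<in>Mult H. Mult_adj H ip \<phi> ` J \<subseteq> J)"

definition mult_dom :: "('x \<Rightarrow> complex) set \<Rightarrow> ('x \<Rightarrow> complex) \<Rightarrow> ('x \<Rightarrow> complex) set"
  where "mult_dom H h = {f \<in> H. h * f \<in> H}"

definition densely_defined_multiplier ::
    "('x \<Rightarrow> complex) set \<Rightarrow> 'x cinner \<Rightarrow> ('x \<Rightarrow> complex) \<Rightarrow> bool"
  where "densely_defined_multiplier H ip h \<longleftrightarrow> norm_dense H (ip_norm ip) (mult_dom H h)"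

text \<open>\<open>Tstar\<close> is the adjoint of multiplication by \<open>h\<close>, and \<open>HB\<close> is its domain.\<close>

definition HB :: "('x \<Rightarrow> complex) set \<Rightarrow> 'x cinner \<Rightarrow> ('x \<Rightarrow> complex) \<Rightarrow> ('x \<Rightarrow> complex) set"
  where "HB H ip h = adj_dom H ip (mult_dom H h) (\<lambda>f. h * f)"

definition Tstar ::
    "('x \<Rightarrow> complex) set \<Rightarrow> 'x cinner \<Rightarrow> ('x \<Rightarrow> complex) \<Rightarrow> ('x \<Rightarrow> complex) \<Rightarrow> 'x \<Rightarrow> complex"
  where "Tstar H ip h = adj H ip (mult_dom H h) (\<lambda>f. h * f)"

definition HB_norm ::
    "('x \<Rightarrow> complex) set \<Rightarrow> 'x cinner \<Rightarrow> ('x \<Rightarrow> complex) \<Rightarrow> ('x \<Rightarrow> complex) \<Rightarrow> real"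
  where "HB_norm H ip h = graph_norm ip (Tstar H ip h)"

definition closed_star_invariant_subspace ::
    "('x \<Rightarrow> complex) set \<Rightarrow> 'x cinner \<Rightarrow> ('x \<Rightarrow> complex) set \<Rightarrow> (('x \<Rightarrow> complex) \<Rightarrow> real) \<Rightarrow>
     ('x \<Rightarrow> complex) set \<Rightarrow> bool"
  where "closed_star_invariant_subspace H ip V N J \<longleftrightarrow>
    cfun.subspace J \<and> closedin (norm_topology V N) J \<and> star_invariant H ip J"

end

(*
  Let g lie in the H-closure of J and in the domain of T*, orthogonal to J for the graph inner
  product; one has to show g = 0. The pairs (n1, n2) in H x H that annihilate the graph of T* over J
  are stable under multipliers, and (g, T* g) is one of them. If q and h q are multipliers, then
  q (n1, n2) differs from (q n1 + h q n2, 0) by (- h q n2, q n2), which annihilates the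
  whole graph of T*. So q n1 + h q n2 is orthogonal to J, hence to g, and (g, T* g) is orthogonal
  to q (n1, n2). It remains to remove q and then to take (n1, n2) = (g, T* g).

  Both are limits based on one fact about CNP spaces: for f1, f2 in H there are multipliers phi_m
  such that phi_m f1 and phi_m f2 are multipliers and phi_m tends to 1 weakly. Take
  phi = 1 / (1 + t D) with D(x) = <f1, k_x f1> + <f2, k_x f2> and let t tend to 0. For f in the span
  of the kernel functions D is a multiplier with 2 Re <D g, g> >= |f1 g|^2 + |f2 g|^2, because the
  row of the coordinates of u is a contraction; so phi is a contraction and phi f1, phi f2 are
  bounded by t^(-1/2), uniformly in f.
*)

theory Submission
  imports Defs
begin

section \<open>Hilbert spaces of functions\<close>

text \<open>The obstacle is that T* is unbounded: \<open>g\<close> is an H-limit of elements of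
  \<open>J\<close>, but their images under T* need not converge. Replacing (q n1, q n2) by (q n1 + h
  q n2, 0) gets around this, since nothing is then paired with T* g. Suitable \<open>q\<close> are
  products phi f with \<open>f\<close> in the domain of T: here h q = phi (h f), and the
  approximation applied to \<open>f\<close> and h f makes both products multipliers.

  Removing \<open>q\<close> takes two limits. Letting phi tend to 1 weakly leaves the factor
  \<open>f\<close>; as the domain of T is dense and the constant 1 lies in H, \<open>f\<close> can
  then be sent to 1 in norm. Both limits want n1 and n2 to be multipliers, because a product of two
  elements of H may fall outside H. So they are run for phi (g, T* g), an annihilator by the
  invariance of \<open>J\<close>, and a last weak limit returns to (g, T* g).

  The multiplier D is accretive, so 1 / (1 + t D) acts as the resolvent of an accretive operator;
  this is where the contraction bound comes from. Adding the contributions of f1 and f2 in one D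
  provides a common denominator for both.\<close>

lemma cscale_apply [simp]: "cscale c f x = c * f x"
  by (simp add: cscale_def)

lemma fun_sum_apply [simp]: "(\<Sum>i\<in>I. f i) x = (\<Sum>i\<in>I. f i x)"
  for f :: "'i \<Rightarrow> 'x \<Rightarrow> 'b::comm_monoid_add"
  by (induction I rule: infinite_finite_induct) auto

lemma mult_cscale: "\<phi> * cscale c f = cscale c (\<phi> * f)"
  by (auto simp: fun_eq_iff)

lemma mult_diff_fun: "\<phi> * (f - g) = \<phi> * f - \<phi> * g"
  for \<phi> f g :: "'x \<Rightarrow> complex"
  by (auto simp: fun_eq_iff algebra_simps)

context hilbert_function_space
begin

abbreviation nrm :: "('x \<Rightarrow> complex) \<Rightarrow> real"
  where "nrm \<equiv> ip_norm ip"

lemma zero_mem [simp]: "0 \<in> H"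
  and add_mem [simp]: "f \<in> H \<Longrightarrow> g \<in> H \<Longrightarrow> f + g \<in> H"
  and scale_mem [simp]: "f \<in> H \<Longrightarrow> cscale c f \<in> H"
  and diff_mem [simp]: "f \<in> H \<Longrightarrow> g \<in> H \<Longrightarrow> f - g \<in> H"
  and sum_mem: "(\<And>i. i \<in> I \<Longrightarrow> F i \<in> H) \<Longrightarrow> (\<Sum>i\<in>I. F i) \<in> H"
  using subspace
  by (auto intro: cfun.subspace_0 cfun.subspace_add cfun.subspace_scale cfun.subspace_diff
      cfun.subspace_sum)

lemma ip_add_right: "f \<in> H \<Longrightarrow> g \<in> H \<Longrightarrow> w \<in> H \<Longrightarrow> ip w (f + g) = ip w f + ip w g"
  using ip_add[of f g w] ip_cnj[of _ w] by (metis add_mem complex_cnj_add)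

lemma ip_scale_right: "f \<in> H \<Longrightarrow> w \<in> H \<Longrightarrow> ip w (cscale c f) = cnj c * ip w f"
  using ip_scale[of f w c] ip_cnj[of _ w] by (metis scale_mem complex_cnj_mult)

lemma ip_zero_left [simp]: "w \<in> H \<Longrightarrow> ip 0 w = 0"
  using ip_add[of 0 0 w] by simp

lemma ip_zero_right [simp]: "w \<in> H \<Longrightarrow> ip w 0 = 0"
  using ip_add_right[of 0 0 w] by simp

lemma ip_diff: "f \<in> H \<Longrightarrow> g \<in> H \<Longrightarrow> w \<in> H \<Longrightarrow> ip (f - g) w = ip f w - ip g w"
  using ip_add[of "f - g" g w] by simp

lemma ip_diff_right: "f \<in> H \<Longrightarrow> g \<in> H \<Longrightarrow> w \<in> H \<Longrightarrow> ip w (f - g) = ip w f - ip w g"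
  using ip_add_right[of "f - g" g w] by simp

lemma ip_sum: "(\<And>i. i \<in> I \<Longrightarrow> F i \<in> H) \<Longrightarrow> w \<in> H \<Longrightarrow> ip (\<Sum>i\<in>I. F i) w = (\<Sum>i\<in>I. ip (F i) w)"
  by (induction I rule: infinite_finite_induct) (auto simp: ip_add sum_mem)

lemma ip_sum_right:
  "(\<And>i. i \<in> I \<Longrightarrow> F i \<in> H) \<Longrightarrow> w \<in> H \<Longrightarrow> ip w (\<Sum>i\<in>I. F i) = (\<Sum>i\<in>I. ip w (F i))"
  by (induction I rule: infinite_finite_induct) (auto simp: ip_add_right sum_mem)

lemma Re_ip_nonneg: "f \<in> H \<Longrightarrow> 0 \<le> Re (ip f f)"
  using ip_pos[of f] by (cases "f = 0") auto

lemma Re_ip_self: "f \<in> H \<Longrightarrow> Re (ip f f) = (nrm f)\<^sup>2"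
  using Re_ip_nonneg[of f] by (simp add: ip_norm_def)

lemma ip_self: "f \<in> H \<Longrightarrow> ip f f = of_real ((nrm f)\<^sup>2)"
  using Re_ip_self[of f] ip_cnj[of f f] by (simp add: complex_eq_iff)

lemma nrm_nonneg [simp]: "f \<in> H \<Longrightarrow> 0 \<le> nrm f"
  using Re_ip_nonneg[of f] by (simp add: ip_norm_def)

lemma nrm_zero [simp]: "nrm 0 = 0"
  by (simp add: ip_norm_def)

lemma nrm_eq_0_iff: "f \<in> H \<Longrightarrow> nrm f = 0 \<longleftrightarrow> f = 0"
  using ip_pos[of f] by (cases "f = 0") (auto simp: ip_norm_def)

lemma nrm_scale: "f \<in> H \<Longrightarrow> nrm (cscale c f) = cmod c * nrm f"
proof -
  assume f: "f \<in> H"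
  have "ip (cscale c f) (cscale c f) = (c * cnj c) * ip f f"
    using f by (simp add: ip_scale ip_scale_right)
  also have "\<dots> = of_real ((cmod c * nrm f)\<^sup>2)"
    using f by (simp add: ip_self power_mult_distrib flip: complex_norm_square)
  finally have "Re (ip (cscale c f) (cscale c f)) = (cmod c * nrm f)\<^sup>2"
    by (metis Re_complex_of_real)
  then show ?thesis
    using f unfolding ip_norm_def[of _ "cscale c f"] by (simp add: abs_mult)
qed

lemma nrm_diff_commute: "f \<in> H \<Longrightarrow> g \<in> H \<Longrightarrow> nrm (f - g) = nrm (g - f)"
  using nrm_scale[of "f - g" "-1"] by (simp add: cfun.scale_minus_left)

lemma nrm_add_sq: "f \<in> H \<Longrightarrow> g \<in> H \<Longrightarrow> (nrm (f + g))\<^sup>2 = (nrm f)\<^sup>2 + 2 * Re (ip f g) + (nrm g)\<^sup>2"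
  using ip_cnj[of f g] by (simp add: Re_ip_self[symmetric] ip_add ip_add_right)

lemma nrm_diff_sq: "f \<in> H \<Longrightarrow> g \<in> H \<Longrightarrow> (nrm (f - g))\<^sup>2 = (nrm f)\<^sup>2 - 2 * Re (ip f g) + (nrm g)\<^sup>2"
  using ip_cnj[of f g] by (simp add: Re_ip_self[symmetric] ip_diff ip_diff_right)

lemma cauchy_schwarz:
  assumes f: "f \<in> H" and g: "g \<in> H"
  shows "cmod (ip f g) \<le> nrm f * nrm g"
proof (cases "g = 0")
  case True
  then show ?thesis using f by simp
next
  case False
  define n where "n = (nrm g)\<^sup>2"
  have n: "n > 0" using False g nrm_eq_0_iff[OF g] nrm_nonneg[OF g] by (simp add: n_def)
  define c where "c = ip f g / n"
  have "0 \<le> (nrm (f - cscale c g))\<^sup>2" by simp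
  also have "\<dots> = (nrm f)\<^sup>2 - 2 * Re (cnj c * ip f g) + (cmod c)\<^sup>2 * n"
    using f g by (simp add: nrm_diff_sq ip_scale_right nrm_scale power_mult_distrib n_def)
  also have "cnj c * ip f g = (cmod (ip f g))\<^sup>2 / n"
    by (simp add: c_def mult.commute flip: complex_norm_square)
  also have "(cmod c)\<^sup>2 * n = (cmod (ip f g))\<^sup>2 / n"
    using n by (simp add: c_def norm_divide power_divide power2_eq_square)
  finally have "(cmod (ip f g))\<^sup>2 / n \<le> (nrm f)\<^sup>2"
    by simp
  then have "(cmod (ip f g))\<^sup>2 \<le> (nrm f * nrm g)\<^sup>2"
    using n by (simp add: field_simps n_def power_mult_distrib)
  then show ?thesis by (rule power2_le_imp_le) (use f g in simp)
qed

lemma nrm_triangle: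
  assumes f: "f \<in> H" and g: "g \<in> H"
  shows "nrm (f + g) \<le> nrm f + nrm g"
proof -
  have "(nrm (f + g))\<^sup>2 \<le> (nrm f + nrm g)\<^sup>2"
    using complex_Re_le_cmod[of "ip f g"] cauchy_schwarz[OF f g]
    by (simp add: nrm_add_sq[OF f g] power2_sum)
  then show ?thesis by (rule power2_le_imp_le) (use f g in simp)
qed

lemma nrm_triangle_diff:
  assumes "f \<in> H" "g \<in> H" "w \<in> H"
  shows "nrm (f - w) \<le> nrm (f - g) + nrm (g - w)"
  using nrm_triangle[of "f - g" "g - w"] assms by simp

lemma nrm_diff_ineq:
  assumes "f \<in> H" "g \<in> H"
  shows "\<bar>nrm f - nrm g\<bar> \<le> nrm (f - g)"
proof -
  have "nrm f \<le> nrm (f - g) + nrm g" using nrm_triangle[of "f - g" g] assms by simp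
  moreover have "nrm g \<le> nrm (g - f) + nrm f" using nrm_triangle[of "g - f" f] assms by simp
  ultimately show ?thesis using nrm_diff_commute[OF assms] by linarith
qed

lemma metric: "Metric_space H (norm_dist H nrm)"
proof
  show "0 \<le> norm_dist H nrm f g" for f g
    by (simp add: norm_dist_def)
  show "norm_dist H nrm f g = norm_dist H nrm g f" for f g
    using nrm_diff_commute[of f g] by (simp add: norm_dist_def)
  show "norm_dist H nrm f g = 0 \<longleftrightarrow> f = g" if "f \<in> H" "g \<in> H" for f g
    using that by (simp add: norm_dist_def nrm_eq_0_iff)
  show "norm_dist H nrm f w \<le> norm_dist H nrm f g + norm_dist H nrm g w"
    if "f \<in> H" "g \<in> H" "w \<in> H" for f g w
    using that by (simp add: norm_dist_def nrm_triangle_diff)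
qed

section \<open>Norm closures and limits of sequences\<close>

lemma closure_of_iff:
  assumes "S \<subseteq> H"
  shows "g \<in> norm_topology H nrm closure_of S \<longleftrightarrow> g \<in> H \<and> (\<forall>\<epsilon>>0. \<exists>f\<in>S. nrm (g - f) < \<epsilon>)"
proof -
  have "(\<exists>f\<in>S. f \<in> Metric_space.mball H (norm_dist H nrm) g \<epsilon>) \<longleftrightarrow> (\<exists>f\<in>S. nrm (g - f) < \<epsilon>)"
    if "g \<in> H" for \<epsilon>
    unfolding Metric_space.in_mball[OF metric]
    by (intro bex_cong refl) (use assms that in \<open>auto simp: norm_dist_def\<close>)
  then show ?thesis
    unfolding norm_topology_def Metric_space.metric_closure_of[OF metric] mem_Collect_eq
    by blast
qed

lemma closure_of_iff_seq:
  assumes "S \<subseteq> H"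
  shows "g \<in> norm_topology H nrm closure_of S \<longleftrightarrow>
    g \<in> H \<and> (\<exists>F. range F \<subseteq> S \<and> (\<lambda>n. nrm (F n - g)) \<longlonglongrightarrow> 0)" (is "_ \<longleftrightarrow> ?R")
proof
  assume "g \<in> norm_topology H nrm closure_of S"
  then have g: "g \<in> H" "\<forall>\<epsilon>>0. \<exists>f\<in>S. nrm (g - f) < \<epsilon>"
    using closure_of_iff[OF assms] by auto
  then have "\<forall>n. \<exists>f. f \<in> S \<and> nrm (g - f) < inverse (real (Suc n))" by (metis inverse_positive_iff_positive of_nat_0_less_iff zero_less_Suc)
  then obtain F where F: "\<And>n. F n \<in> S" "\<And>n. nrm (g - F n) < inverse (real (Suc n))"
    by metis
  have "(\<lambda>n. nrm (F n - g)) \<longlonglongrightarrow> 0"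
  proof (rule tendsto_sandwich[OF _ _ tendsto_const LIMSEQ_inverse_real_of_nat])
    show "\<forall>\<^sub>F n in sequentially. 0 \<le> nrm (F n - g)"
      by (intro always_eventually allI nrm_nonneg diff_mem) (use F(1) assms g(1) in auto)
    show "\<forall>\<^sub>F n in sequentially. nrm (F n - g) \<le> inverse (real (Suc n))"
      using F assms g(1) nrm_diff_commute[of g] 
      by (intro always_eventually) (metis less_imp_le subsetD)
  qed
  then show ?R using F g by auto
next
  assume ?R
  then obtain F where g: "g \<in> H" and F: "range F \<subseteq> S" "(\<lambda>n. nrm (F n - g)) \<longlonglongrightarrow> 0" by auto
  have "\<exists>f\<in>S. nrm (g - f) < \<epsilon>" if "\<epsilon> > 0" for \<epsilon>
  proof -
    have "\<forall>\<^sub>F n in sequentially. nrm (F n - g) < \<epsilon>"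
      using order_tendstoD(2)[OF F(2) that] .
    then obtain n where "nrm (F n - g) < \<epsilon>" by (auto simp: eventually_sequentially)
    moreover have "F n \<in> S" using F by auto
    ultimately show ?thesis using nrm_diff_commute[OF g, of "F n"] assms by (metis subsetD)
  qed
  then show "g \<in> norm_topology H nrm closure_of S"
    using closure_of_iff[OF assms] g by auto
qed

lemma cauchy_convergent:
  assumes F: "\<And>n. F n \<in> H" and c: "\<And>\<epsilon>. \<epsilon> > 0 \<Longrightarrow> \<exists>N. \<forall>m\<ge>N. \<forall>n\<ge>N. nrm (F m - F n) < \<epsilon>"
  shows "\<exists>f\<in>H. (\<lambda>n. nrm (F n - f)) \<longlonglongrightarrow> 0"
proof -
  have "Metric_space.MCauchy H (norm_dist H nrm) F"
    unfolding Metric_space.MCauchy_def[OF metric] using assms by (force simp: norm_dist_def)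
  then obtain f where "limitin (Metric_space.mtopology H (norm_dist H nrm)) F f sequentially"
    using complete Metric_space.mcomplete_def[OF metric] by blast
  then have "f \<in> H" "\<forall>\<epsilon>>0. \<forall>\<^sub>F n in sequentially. F n \<in> H \<and> norm_dist H nrm (F n) f < \<epsilon>"
    unfolding Metric_space.limitin_metric[OF metric] by auto
  then show ?thesis
    using F by (auto simp: norm_dist_def tendsto_iff intro!: bexI[of _ f])
qed

lemma nrm_tendsto:
  assumes "\<And>n. F n \<in> H" "f \<in> H" "(\<lambda>n. nrm (F n - f)) \<longlonglongrightarrow> 0"
  shows "(\<lambda>n. nrm (F n)) \<longlonglongrightarrow> nrm f"
proof -
  have "(\<lambda>n. nrm (F n) - nrm f) \<longlonglongrightarrow> 0"
    by (rule Lim_null_comparison[OF _ assms(3)]) (use assms in \<open>auto simp: nrm_diff_ineq\<close>)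
  then show ?thesis by (simp add: LIM_zero_iff)
qed

lemma ip_tendsto:
  assumes "\<And>n. F n \<in> H" "f \<in> H" "(\<lambda>n. nrm (F n - f)) \<longlonglongrightarrow> 0"
    and "\<And>n. G n \<in> H" "g \<in> H" "(\<lambda>n. nrm (G n - g)) \<longlonglongrightarrow> 0"
  shows "(\<lambda>n. ip (F n) (G n)) \<longlonglongrightarrow> ip f g"
proof -
  have "(\<lambda>n. ip (F n) (G n) - ip f g) \<longlonglongrightarrow> 0"
  proof (rule Lim_null_comparison)
    show "\<forall>\<^sub>F n in sequentially. norm (ip (F n) (G n) - ip f g) \<le> nrm (F n - f) * nrm (G n) + nrm f * nrm (G n - g)"
    proof (intro always_eventually allI)
      fix n
      have "ip (F n) (G n) - ip f g = ip (F n - f) (G n) + ip f (G n - g)"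
        using assms by (simp add: ip_diff ip_diff_right)
      then show "norm (ip (F n) (G n) - ip f g) \<le> nrm (F n - f) * nrm (G n) + nrm f * nrm (G n - g)"
        using assms cauchy_schwarz[of "F n - f" "G n"] cauchy_schwarz[of f "G n - g"]
        by (metis (no_types, lifting) add_mono_thms_linordered_semiring(1) diff_mem norm_triangle_le)
    qed
    show "(\<lambda>n. nrm (F n - f) * nrm (G n) + nrm f * nrm (G n - g)) \<longlonglongrightarrow> 0"
      by (rule tendsto_eq_intros assms nrm_tendsto[of G g] refl | simp)+
  qed
  then show ?thesis by (simp add: LIM_zero_iff)
qed

lemma ip_tendsto_left:
  assumes "\<And>n. F n \<in> H" "f \<in> H" "(\<lambda>n. nrm (F n - f)) \<longlonglongrightarrow> 0" "g \<in> H"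
  shows "(\<lambda>n. ip (F n) g) \<longlonglongrightarrow> ip f g"
  using ip_tendsto[of F f "\<lambda>_. g" g] assms by simp

text \<open>The minimising sequence is Cauchy by the parallelogram law.\<close>

lemma minimal_norm:
  assumes P: "P \<subseteq> H" "P \<noteq> {}" and mid: "\<And>f g. f \<in> P \<Longrightarrow> g \<in> P \<Longrightarrow> cscale (1/2) (f + g) \<in> P"
  shows "\<exists>p\<in>H. \<exists>F. range F \<subseteq> P \<and> (\<lambda>n. nrm (F n - p)) \<longlonglongrightarrow> 0 \<and>
    (\<forall>e\<in>H. (\<forall>f\<in>P. \<forall>c. f + cscale c e \<in> P) \<longrightarrow> ip e p = 0)"
proof -
  define m where "m = (INF f\<in>P. nrm f)"
  have bdd: "bdd_below (nrm ` P)" using P by (intro bdd_belowI[of _ 0]) auto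
  have m_le: "m \<le> nrm f" if "f \<in> P" for f
    unfolding m_def by (rule cINF_lower[OF bdd that])
  have m0: "0 \<le> m" unfolding m_def using P by (intro cINF_greatest) auto
  have ex: "\<exists>f\<in>P. nrm f < m + \<epsilon>" if "\<epsilon> > 0" for \<epsilon>
    using cINF_less_iff[OF P(2) bdd, of "m + \<epsilon>"] that by (auto simp: m_def)
  have "\<forall>n. \<exists>f. f \<in> P \<and> nrm f < m + inverse (real (Suc n))"
    using ex by (metis inverse_positive_iff_positive of_nat_0_less_iff zero_less_Suc)
  then obtain F where F: "\<And>n. F n \<in> P" "\<And>n. nrm (F n) < m + inverse (real (Suc n))"
    by metis
  have FH: "F n \<in> H" for n using F P by auto
  have lim: "(\<lambda>n. nrm (F n)) \<longlonglongrightarrow> m"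
  proof (rule tendsto_sandwich[OF _ _ tendsto_const LIMSEQ_inverse_real_of_nat_add])
    show "\<forall>\<^sub>F n in sequentially. m \<le> nrm (F n)"
      using F(1) m_le by (auto intro!: always_eventually)
    show "\<forall>\<^sub>F n in sequentially. nrm (F n) \<le> m + inverse (real (Suc n))"
      using F(2) by (auto intro!: always_eventually less_imp_le)
  qed
  have par: "(nrm (F i - F j))\<^sup>2 \<le> 2 * ((nrm (F i))\<^sup>2 - m\<^sup>2) + 2 * ((nrm (F j))\<^sup>2 - m\<^sup>2)" for i j
  proof -
    have "m \<le> nrm (cscale (1/2) (F i + F j))" using mid F m_le by auto
    also have "\<dots> = nrm (F i + F j) / 2" using FH by (simp add: nrm_scale)
    finally have "(2 * m)\<^sup>2 \<le> (nrm (F i + F j))\<^sup>2" using m0 by (intro power_mono) auto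
    then show ?thesis using FH[of i] FH[of j]
      by (simp add: nrm_diff_sq nrm_add_sq power_mult_distrib)
  qed
  have "\<exists>N. \<forall>i\<ge>N. \<forall>j\<ge>N. nrm (F i - F j) < \<epsilon>" if "\<epsilon> > 0" for \<epsilon>
  proof -
    have "(\<lambda>n. (nrm (F n))\<^sup>2 - m\<^sup>2) \<longlonglongrightarrow> m\<^sup>2 - m\<^sup>2" by (intro tendsto_intros lim)
    then have "\<forall>\<^sub>F n in sequentially. (nrm (F n))\<^sup>2 - m\<^sup>2 < \<epsilon>\<^sup>2 / 8"
      by (intro order_tendstoD(2)) (use that in auto)
    then obtain N where N: "\<And>n. n \<ge> N \<Longrightarrow> (nrm (F n))\<^sup>2 - m\<^sup>2 < \<epsilon>\<^sup>2 / 8"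
      by (auto simp: eventually_sequentially)
    have "nrm (F i - F j) < \<epsilon>" if "i \<ge> N" "j \<ge> N" for i j
    proof -
      have aux: "x < e" if "x \<le> 2 * (a - m) + 2 * (b - m)" "a - m < e / 8" "b - m < e / 8" "0 < e"
        for x a b m e :: real using that by argo
      have "(nrm (F i - F j))\<^sup>2 < \<epsilon>\<^sup>2"
        by (rule aux[OF par N[OF that(1)] N[OF that(2)] zero_less_power[OF \<open>\<epsilon> > 0\<close>]])
      then show ?thesis by (rule power2_less_imp_less) (use \<open>\<epsilon> > 0\<close> in simp)
    qed
    then show ?thesis by blast
  qed
  then obtain p where p: "p \<in> H" "(\<lambda>n. nrm (F n - p)) \<longlonglongrightarrow> 0"
    using cauchy_convergent[of F] FH by blast
  have np: "nrm p = m" using LIMSEQ_unique[OF nrm_tendsto[OF FH p] lim] .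
  \<comment> \<open>\<open>P\<close> need not be closed and \<open>p\<close> is only a limit of its
    points, so the minimality of \<open>p\<close> in the direction \<open>e\<close> is obtained as a
    limit of \<open>m \<le> nrm (F n + cscale c e)\<close>.\<close>
  have "ip e p = 0" if e: "e \<in> H" and dir: "\<forall>f\<in>P. \<forall>c. f + cscale c e \<in> P" for e
  proof -
    have ineq: "(nrm p)\<^sup>2 \<le> (nrm (p + cscale c e))\<^sup>2" for c
    proof -
      have l: "(\<lambda>n. nrm (F n + cscale c e)) \<longlonglongrightarrow> nrm (p + cscale c e)"
        by (rule nrm_tendsto) (use FH e p in auto)
      have "m \<le> nrm (p + cscale c e)"
        by (rule Lim_bounded2[OF l]) (use m_le dir F in auto)
      then show ?thesis using np m0 by simp
    qed
    show ?thesis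
    proof (cases "e = 0")
      case False
      define n where "n = (nrm e)\<^sup>2"
      have n: "n > 0" using False e nrm_eq_0_iff[OF e] nrm_nonneg[OF e] by (simp add: n_def)
      define a where "a = ip p e"
      \<comment> \<open>The minimiser of the quadratic function sending \<open>c\<close> to the
        squared norm of \<open>p + cscale c e\<close>. Its minimum lies below the squared norm of
        \<open>p\<close> by \<open>(cmod a)\<^sup>2 / n\<close>, which forces
        \<open>a = 0\<close>.\<close>
      define c where "c = - a / n"
      have "0 \<le> 2 * Re (cnj c * a) + (cmod c)\<^sup>2 * n"
        using ineq[of c] p e 
        by (simp add: nrm_add_sq ip_scale_right nrm_scale power_mult_distrib n_def a_def)
      also have "cnj c * a = - ((cmod a)\<^sup>2 / n)"
        by (simp add: c_def mult.commute flip: complex_norm_square)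
      also have "(cmod c)\<^sup>2 * n = (cmod a)\<^sup>2 / n"
        using n by (simp add: c_def norm_divide power_divide power2_eq_square)
      finally have "(cmod a)\<^sup>2 / n \<le> 0" by simp
      then have "a = 0" using n by (simp add: field_simps)
      then show ?thesis using ip_cnj[OF p(1) e] by (simp add: a_def)
    qed (use p in simp)
  qed
  then show ?thesis using p F by blast
qed

text \<open>The limit \<open>p\<close> of least norm for the translate \<open>g - J\<close> is
  orthogonal to \<open>J\<close>, because the translate absorbs all multiples of elements of
  \<open>J\<close>. Since \<open>J\<close> may fail to be closed, \<open>g - p\<close> is located in
  its closure only.\<close>

lemma projection:
  assumes J: "cfun.subspace J" "J \<subseteq> H" and g: "g \<in> H"
  shows "\<exists>p\<in>H. g - p \<in> norm_topology H nrm closure_of J \<and> (\<forall>j\<in>J. ip j p = 0)"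
proof -
  define P where "P = (\<lambda>j. g - j) ` J"
  have PH: "P \<subseteq> H" using J g by (auto simp: P_def)
  have Pne: "P \<noteq> {}" using cfun.subspace_0[OF J(1)] by (auto simp: P_def)
  have mid: "cscale (1/2) (f1 + f2) \<in> P" if "f1 \<in> P" "f2 \<in> P" for f1 f2
  proof -
    obtain j1 j2 where j: "f1 = g - j1" "f2 = g - j2" "j1 \<in> J" "j2 \<in> J"
      using \<open>f1 \<in> P\<close> \<open>f2 \<in> P\<close> by (auto simp: P_def)
    have "cscale (1/2) (j1 + j2) \<in> J" using J j by (intro cfun.subspace_scale cfun.subspace_add)
    moreover have "cscale (1/2) (f1 + f2) = g - cscale (1/2) (j1 + j2)"
      by (auto simp: fun_eq_iff j field_simps)
    ultimately show ?thesis by (auto simp: P_def)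
  qed
  obtain p F where p: "p \<in> H" "range F \<subseteq> P" "(\<lambda>n. nrm (F n - p)) \<longlonglongrightarrow> 0"
    and orth: "\<And>e. e \<in> H \<Longrightarrow> (\<forall>f\<in>P. \<forall>c. f + cscale c e \<in> P) \<Longrightarrow> ip e p = 0"
    using minimal_norm[OF PH Pne mid] by blast
  have "ip j p = 0" if "j \<in> J" for j
  proof (rule orth)
    show "\<forall>f\<in>P. \<forall>c. f + cscale c j \<in> P"
    proof safe
      fix f c assume "f \<in> P"
      then obtain i where i: "f = g - i" "i \<in> J" by (auto simp: P_def)
      have "i - cscale c j \<in> J" using J i that by (intro cfun.subspace_diff cfun.subspace_scale)
      then show "f + cscale c j \<in> P" unfolding P_def i by (rule rev_image_eqI) simp
    qed
  qed (use that J in auto)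
  moreover have "g - p \<in> norm_topology H nrm closure_of J"
  proof -
    define G where "G n = g - F n" for n
    have "G n \<in> J" for n
    proof -
      have "F n \<in> P" using p by auto
      then show ?thesis by (auto simp: P_def G_def)
    qed
    moreover have "nrm (G n - (g - p)) = nrm (F n - p)" for n
      using nrm_diff_commute[of "F n" p] p PH by (auto simp: G_def subset_iff)
    ultimately show ?thesis
      unfolding closure_of_iff_seq[OF J(2)] using p g by (auto intro!: exI[of _ G])
  qed
  ultimately show ?thesis using p by blast
qed

text \<open>
  A relation \<open>R\<close> stands for a conjugate linear functional given on representations of
  vectors; single-valuedness is a consequence of the bound.
\<close>

lemma riesz_relation:
  assumes mem: "\<And>e a. R e a \<Longrightarrow> e \<in> H"
    and bound: "\<And>e a. R e a \<Longrightarrow> cmod a \<le> C * nrm e"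
    and add: "\<And>e e' a a'. R e a \<Longrightarrow> R e' a' \<Longrightarrow> R (e + e') (a + a')"
    and scale: "\<And>c e a. R e a \<Longrightarrow> R (cscale c e) (cnj c * a)"
    and C: "C \<ge> 0"
  shows "\<exists>g\<in>H. nrm g \<le> C \<and> (\<forall>e a. R e a \<longrightarrow> ip g e = a)"
proof (cases "\<exists>e a. R e a \<and> a \<noteq> 0")
  case False
  then show ?thesis using mem C by (intro bexI[of _ 0]) auto
next
  case True
  then obtain e0 a0 where e0: "R e0 a0" "a0 \<noteq> 0" by auto
  \<comment> \<open>The affine hyperplane on which the functional takes the value 1. Its limit
    \<open>p\<close> of least norm is orthogonal to the kernel of the functional, and the bound
    \<open>C\<close> keeps \<open>p\<close> away from 0.\<close>
  define P where "P = {e. R e 1}"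
  have R1: "R (cscale (cnj (1 / a0)) e0) 1" using scale[OF e0(1), of "cnj (1 / a0)"] e0 by simp
  have PH: "P \<subseteq> H" using mem by (auto simp: P_def)
  have Pne: "P \<noteq> {}" using R1 by (auto simp: P_def)
  have mid: "cscale (1/2) (f + g) \<in> P" if "f \<in> P" "g \<in> P" for f g
    using scale[OF add[of f 1 g 1], of "1/2"] that by (simp add: P_def)
  obtain p F where p: "p \<in> H" "range F \<subseteq> P" "(\<lambda>n. nrm (F n - p)) \<longlonglongrightarrow> 0"
    and orth: "\<And>e. e \<in> H \<Longrightarrow> (\<forall>f\<in>P. \<forall>c. f + cscale c e \<in> P) \<Longrightarrow> ip e p = 0"
    using minimal_norm[OF PH Pne mid] by blast
  have FP: "R (F n) 1" for n using p by (auto simp: P_def)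
  have FH: "F n \<in> H" for n using FP mem by auto
  have "1 \<le> C * nrm p"
    by (rule Lim_bounded2[OF tendsto_mult_left[OF nrm_tendsto[OF FH p(1,3)], of C]])
      (use bound[OF FP] in auto)
  then have np: "nrm p > 0" using C nrm_nonneg[OF p(1)] 
    by (metis less_eq_real_def mult_zero_right not_one_le_zero)
  have zero: "ip e p = 0" if "R e 0" for e
  proof (rule orth)
    show "\<forall>f\<in>P. \<forall>c. f + cscale c e \<in> P"
      using add[OF _ scale[OF that]] by (fastforce simp: P_def)
  qed (use that mem in auto)
  \<comment> \<open>The multiple of \<open>p\<close> normalised to
    \<open>ip g p = 1\<close>.\<close>
  define g where "g = cscale (1 / of_real ((nrm p)\<^sup>2)) p"
  have "ip g e = a" if Re: "R e a" for e a
  proof -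
    have eH: "e \<in> H" using mem Re .
    \<comment> \<open>As a mere limit, \<open>p\<close> need not be related to 1 by
      \<open>R\<close>. So \<open>e\<close> is compared with the approximants: subtracting
      \<open>cnj a\<close> times \<open>F n\<close> brings the value down to 0.\<close>
    have const: "ip e p = cnj a * ip (F n) p" for n
    proof -
      have "R (e + cscale (- cnj a) (F n)) (a + cnj (- cnj a) * 1)"
        by (intro add scale Re FP)
      then have "ip (e + cscale (- cnj a) (F n)) p = 0" by (intro zero) simp
      then show ?thesis using eH FH[of n] p(1) by (simp add: ip_add ip_diff ip_scale)
    qed
    have "(\<lambda>n. cnj a * ip (F n) p) \<longlonglongrightarrow> cnj a * ip p p"
      by (intro tendsto_mult_left ip_tendsto_left FH p)
    then have "ip e p = cnj a * ip p p"
      unfolding const[symmetric] by (simp add: LIMSEQ_const_iff)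
    then have "ip p e = a * of_real ((nrm p)\<^sup>2)"
      using ip_cnj[OF eH p(1)] p(1) by (simp add: ip_self)
    then show ?thesis using np p(1) eH by (simp add: g_def ip_scale)
  qed
  moreover have "nrm g \<le> C"
  proof -
    have "nrm g = 1 / nrm p" using p(1) np 
      by (simp add: g_def nrm_scale norm_divide norm_mult power2_eq_square)
    also have "\<dots> \<le> C" using \<open>1 \<le> C * nrm p\<close> np by (simp add: field_simps)
    finally show ?thesis .
  qed
  moreover have "g \<in> H" using p(1) by (simp add: g_def)
  ultimately show ?thesis by blast
qed

lemma eq_0_if_orthogonal_dense:
  assumes "J \<subseteq> H" "norm_topology H nrm closure_of J = H" "p \<in> H" "\<And>j. j \<in> J \<Longrightarrow> ip j p = 0"
  shows "p = 0"
proof -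
  have "p \<in> norm_topology H nrm closure_of J" using assms by simp
  then obtain F where F: "range F \<subseteq> J" "(\<lambda>n. nrm (F n - p)) \<longlonglongrightarrow> 0"
    using closure_of_iff_seq[OF assms(1)] by auto
  then have FJ: "F n \<in> J" for n by auto
  have "(\<lambda>n. ip (F n) p) \<longlonglongrightarrow> ip p p"
    using F FJ assms by (intro ip_tendsto_left) auto
  then have "ip p p = 0" using FJ assms(4) by (simp add: LIMSEQ_const_iff)
  then show ?thesis using ip_pos[OF assms(3)] by force
qed

lemma closure_of_subset_self: "S \<subseteq> H \<Longrightarrow> S \<subseteq> norm_topology H nrm closure_of S"
  unfolding norm_topology_def
  by (rule closure_of_subset) (simp add: Metric_space.topspace_mtopology[OF metric])

lemma closure_of_subset_carrier: "S \<subseteq> H \<Longrightarrow> norm_topology H nrm closure_of S \<subseteq> H"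
  using closure_of_iff by blast

lemma closure_subspace:
  assumes J: "cfun.subspace J" "J \<subseteq> H"
  shows "cfun.subspace (norm_topology H nrm closure_of J)"
proof (rule cfun.subspaceI)
  show "0 \<in> norm_topology H nrm closure_of J"
    using closure_of_subset_self[OF J(2)] cfun.subspace_0[OF J(1)] by blast
next
  fix f g assume "f \<in> norm_topology H nrm closure_of J" "g \<in> norm_topology H nrm closure_of J"
  then obtain F G where fg: "f \<in> H" "g \<in> H" and F: "range F \<subseteq> J" "(\<lambda>n. nrm (F n - f)) \<longlonglongrightarrow> 0"
    and G: "range G \<subseteq> J" "(\<lambda>n. nrm (G n - g)) \<longlonglongrightarrow> 0"
    unfolding closure_of_iff_seq[OF J(2)] by blast
  have FG: "F n \<in> J" "G n \<in> J" "F n \<in> H" "G n \<in> H" for n using F G J by auto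
  have "(\<lambda>n. nrm (F n + G n - (f + g))) \<longlonglongrightarrow> 0"
  proof (rule tendsto_sandwich[OF _ _ tendsto_const])
    show "\<forall>\<^sub>F n in sequentially. 0 \<le> nrm (F n + G n - (f + g))"
      by (intro always_eventually allI nrm_nonneg diff_mem add_mem FG fg)
    show "\<forall>\<^sub>F n in sequentially. nrm (F n + G n - (f + g)) \<le> nrm (F n - f) + nrm (G n - g)"
    proof (intro always_eventually allI)
      show "nrm (F n + G n - (f + g)) \<le> nrm (F n - f) + nrm (G n - g)" for n
        unfolding add_diff_add by (intro nrm_triangle diff_mem FG fg)
    qed
    show "(\<lambda>n. nrm (F n - f) + nrm (G n - g)) \<longlonglongrightarrow> 0"
      using tendsto_add[OF F(2) G(2)] by simp
  qed
  moreover have "range (\<lambda>n. F n + G n) \<subseteq> J" using FG cfun.subspace_add[OF J(1)] by blast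
  ultimately show "f + g \<in> norm_topology H nrm closure_of J"
    unfolding closure_of_iff_seq[OF J(2)] using fg by (intro conjI exI[of _ "\<lambda>n. F n + G n"]) auto
next
  fix c f assume "f \<in> norm_topology H nrm closure_of J"
  then obtain F where f: "f \<in> H" and F: "range F \<subseteq> J" "(\<lambda>n. nrm (F n - f)) \<longlonglongrightarrow> 0"
    unfolding closure_of_iff_seq[OF J(2)] by blast
  have FJ: "F n \<in> J" "F n \<in> H" for n using F J by auto
  have "nrm (cscale c (F n) - cscale c f) = cmod c * nrm (F n - f)" for n
    using FJ f by (simp add: nrm_scale flip: cfun.scale_right_diff_distrib)
  then have "(\<lambda>n. nrm (cscale c (F n) - cscale c f)) \<longlonglongrightarrow> 0"
    using tendsto_mult_left[OF F(2), of "cmod c"] by simp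
  moreover have "range (\<lambda>n. cscale c (F n)) \<subseteq> J" using FJ cfun.subspace_scale[OF J(1)] by blast
  ultimately show "cscale c f \<in> norm_topology H nrm closure_of J"
    unfolding closure_of_iff_seq[OF J(2)] using f
    by (intro conjI exI[of _ "\<lambda>n. cscale c (F n)"]) auto
qed

lemma ip_zero_closure:
  assumes "J \<subseteq> H" "v \<in> H" "\<And>j. j \<in> J \<Longrightarrow> ip v j = 0" "g \<in> norm_topology H nrm closure_of J"
  shows "ip v g = 0"
proof -
  obtain F where g: "g \<in> H" and F: "range F \<subseteq> J" "(\<lambda>n. nrm (F n - g)) \<longlonglongrightarrow> 0"
    using assms(4) unfolding closure_of_iff_seq[OF assms(1)] by blast
  have FJ: "F n \<in> J" "F n \<in> H" for n using F assms(1) by auto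
  have "(\<lambda>n. ip v (F n)) \<longlonglongrightarrow> ip v g"
    by (rule ip_tendsto[of "\<lambda>_. v"]) (use assms FJ g F(2) in auto)
  then show ?thesis using assms(3) FJ by (simp add: LIMSEQ_const_iff)
qed

end

section \<open>Reproducing kernels and multipliers\<close>

context rkhs
begin

section \<open>Kernel functions and their span\<close>

abbreviation K :: "'x \<Rightarrow> 'x \<Rightarrow> complex"
  where "K y \<equiv> (\<lambda>x. k x y)"

text \<open>The coefficients form a function on all of X and \<open>S\<close> marks the part that
  counts, so that combinations over different sets can be padded with zeros to a common set.\<close>

definition lin :: "'x set \<Rightarrow> ('x \<Rightarrow> complex) \<Rightarrow> 'x \<Rightarrow> complex"
  where "lin S d = (\<Sum>y\<in>S. cscale (d y) (K y))"

definition Lin :: "('x \<Rightarrow> complex) set"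
  where "Lin = {lin S d |S d. finite S}"

lemma K_mem [simp]: "K y \<in> H"
  by (rule kernel_mem)

lemma lin_mem [simp]: "lin S d \<in> H"
  by (auto simp: lin_def intro: sum_mem)

lemma Lin_subset: "Lin \<subseteq> H"
  by (auto simp: Lin_def)

lemma lin_apply: "lin S d x = (\<Sum>y\<in>S. d y * k x y)"
  by (simp add: lin_def)

lemma ip_K: "f \<in> H \<Longrightarrow> ip f (K y) = f y"
  by (simp add: reproducing)

lemma ip_K_left: "f \<in> H \<Longrightarrow> ip (K y) f = cnj (f y)"
  using ip_cnj[of f "K y"] by (simp add: ip_K)

lemma ip_lin_right: "f \<in> H \<Longrightarrow> ip f (lin S d) = (\<Sum>z\<in>S. cnj (d z) * f z)"
  by (simp add: lin_def ip_sum_right ip_scale_right ip_K)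

lemma ip_lin_left: "f \<in> H \<Longrightarrow> ip (lin S d) f = (\<Sum>z\<in>S. d z * cnj (f z))"
  by (simp add: lin_def ip_sum ip_scale ip_K_left)

lemma nrm_lin_sq: "(nrm (lin S d))\<^sup>2 = Re (\<Sum>x\<in>S. \<Sum>y\<in>S. cnj (d x) * d y * k x y)"
  unfolding Re_ip_self[OF lin_mem, symmetric] ip_lin_right[OF lin_mem] lin_apply
  by (simp add: sum_distrib_left mult.assoc)

lemma lin_scale: "cscale c (lin S d) = lin S (\<lambda>y. c * d y)"
  by (auto simp: fun_eq_iff lin_apply sum_distrib_left mult.assoc)

lemma lin_plus: "lin S (\<lambda>z. d z + e z) = lin S d + lin S e"
  by (auto simp: fun_eq_iff lin_apply sum.distrib algebra_simps)

lemma sum_restrict_union: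
  "finite S \<Longrightarrow> finite T \<Longrightarrow>
    (\<Sum>x\<in>S \<union> T. g x (if x \<in> S then d x else 0)) = (\<Sum>x\<in>S. g x (d x))"
  if "\<And>x. g x 0 = 0" for g :: "'b \<Rightarrow> 'c::zero \<Rightarrow> 'd::comm_monoid_add"
  using that by (intro sum.mono_neutral_cong_right) auto

lemma lin_extend:
  "finite S \<Longrightarrow> finite T \<Longrightarrow> lin (S \<union> T) (\<lambda>x. if x \<in> S then d x else 0) = lin S d"
  unfolding lin_def by (rule sum_restrict_union) auto

lemma lin_add:
  assumes "finite S" "finite T"
  shows "lin S d + lin T e =
    lin (S \<union> T) (\<lambda>x. (if x \<in> S then d x else 0) + (if x \<in> T then e x else 0))"
proof -
  have "lin S d + lin T e = lin (S \<union> T) (\<lambda>x. if x \<in> S then d x else 0) +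
      lin (T \<union> S) (\<lambda>x. if x \<in> T then e x else 0)"
    using assms by (simp add: lin_extend)
  also have "T \<union> S = S \<union> T" by auto
  finally show ?thesis
    by (auto simp: fun_eq_iff lin_apply sum.distrib algebra_simps)
qed

lemma Lin_subspace: "cfun.subspace Lin"
proof (rule cfun.subspaceI)
  show "0 \<in> Lin" by (auto simp: Lin_def lin_def intro!: exI[of _ "{}"])
  show "f + g \<in> Lin" if "f \<in> Lin" "g \<in> Lin" for f g
  proof -
    obtain S d T e where "f = lin S d" "g = lin T e" "finite S" "finite T"
      using \<open>f \<in> Lin\<close> \<open>g \<in> Lin\<close> by (auto simp: Lin_def)
    then show ?thesis unfolding Lin_def using lin_add[of S T d e] by blast
  qed
  show "cscale c f \<in> Lin" if "f \<in> Lin" for c f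
    using that unfolding Lin_def mem_Collect_eq by (metis lin_scale)
qed

text \<open>The values of \<open>F\<close> prescribe a conjugate linear functional on the kernel
  span, and the bound makes it continuous; its Riesz vector, tested on \<open>K y\<close>, has the
  value \<open>F y\<close>. This is how new elements of \<open>H\<close>, and through them new
  multipliers, are produced.\<close>

lemma mem_if_bounded_on_lin:
  assumes bound: "\<And>S d. finite S \<Longrightarrow> cmod (\<Sum>z\<in>S. cnj (d z) * F z) \<le> C * nrm (lin S d)"
    and C: "C \<ge> 0"
  shows "F \<in> H \<and> nrm F \<le> C"
proof -
  define R where "R e a \<longleftrightarrow> (\<exists>S d. finite S \<and> e = lin S d \<and> a = (\<Sum>z\<in>S. cnj (d z) * F z))" for e a
  have "\<exists>g\<in>H. nrm g \<le> C \<and> (\<forall>e a. R e a \<longrightarrow> ip g e = a)"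
  proof (rule riesz_relation)
    show "R (e + e') (a + a')" if "R e a" "R e' a'" for e e' a a'
    proof -
      obtain S d T d' where *: "finite S" "finite T" "e = lin S d" "e' = lin T d'"
        "a = (\<Sum>z\<in>S. cnj (d z) * F z)" "a' = (\<Sum>z\<in>T. cnj (d' z) * F z)"
        using \<open>R e a\<close> \<open>R e' a'\<close> by (auto simp: R_def)
      define c where "c x = (if x \<in> S then d x else 0) + (if x \<in> T then d' x else 0)" for x
      have "e + e' = lin (S \<union> T) c" using * by (simp add: lin_add c_def[abs_def])
      moreover have "(\<Sum>z\<in>S \<union> T. cnj (c z) * F z) = a + a'"
      proof -
        have 1: "(\<Sum>z\<in>S \<union> T. cnj (if z \<in> S then d z else 0) * F z) = a"
          unfolding * by (rule sum_restrict_union) (use * in auto)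
        have 2: "(\<Sum>z\<in>T \<union> S. cnj (if z \<in> T then d' z else 0) * F z) = a'"
          unfolding * by (rule sum_restrict_union) (use * in auto)
        show ?thesis
          unfolding 1[symmetric] 2[symmetric] Un_commute[of T S] sum.distrib[symmetric]
          by (simp add: c_def algebra_simps)
      qed
      ultimately show ?thesis
        unfolding R_def using * by (intro exI[of _ "S \<union> T"] exI[of _ c]) simp
    qed
    show "R (cscale c e) (cnj c * a)" if Re: "R e a" for c e a
    proof -
      obtain S d where "finite S" "e = lin S d" "a = (\<Sum>z\<in>S. cnj (d z) * F z)"
        using Re by (auto simp: R_def)
      then show ?thesis
        unfolding R_def by (intro exI[of _ S] exI[of _ "\<lambda>y. c * d y"])
          (simp add: lin_scale sum_distrib_left mult.assoc)
    qed
  qed (use bound C in \<open>auto simp: R_def\<close>)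
  then obtain g where g: "g \<in> H" "nrm g \<le> C" "\<And>e a. R e a \<Longrightarrow> ip g e = a" by blast
  have "g y = F y" for y
  proof -
    have "R (K y) (F y)"
      unfolding R_def by (intro exI[of _ "{y}"] exI[of _ "\<lambda>_. 1"]) (simp add: lin_def)
    then show ?thesis using g ip_K[of g y] by simp
  qed
  then show ?thesis using g by (metis ext)
qed

text \<open>The bound against one kernel combination involves finitely many values of
  \<open>G n\<close>, hence survives pointwise limits. This does the work of weak compactness of
  balls.\<close>

lemma pointwise_limit_mem:
  assumes G: "\<And>n. G n \<in> H" "\<And>n. nrm (G n) \<le> C" and lim: "\<And>x. (\<lambda>n. G n x) \<longlonglongrightarrow> g x"
  shows "g \<in> H" "nrm g \<le> C"
proof -
  have C: "C \<ge> 0" using G nrm_nonneg[of "G 0"] order_trans by blast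
  have "g \<in> H \<and> nrm g \<le> C"
  proof (rule mem_if_bounded_on_lin)
    fix S :: "'x set" and d :: "'x \<Rightarrow> complex"
    have l: "(\<lambda>n. \<Sum>z\<in>S. cnj (d z) * G n z) \<longlonglongrightarrow> (\<Sum>z\<in>S. cnj (d z) * g z)"
      by (intro tendsto_intros lim)
    have "cmod (\<Sum>z\<in>S. cnj (d z) * G n z) \<le> C * nrm (lin S d)" for n
      unfolding ip_lin_right[OF G(1), symmetric]
      using cauchy_schwarz[OF G(1) lin_mem] G(2) mult_right_mono[OF G(2) nrm_nonneg[OF lin_mem]]
      by (meson order_trans)
    then show "cmod (\<Sum>z\<in>S. cnj (d z) * g z) \<le> C * nrm (lin S d)"
      by (intro Lim_bounded[OF tendsto_norm[OF l]]) auto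
  qed (rule C)
  then show "g \<in> H" "nrm g \<le> C" by auto
qed

lemma Lin_dense: "norm_topology H nrm closure_of Lin = H"
proof
  show "norm_topology H nrm closure_of Lin \<subseteq> H"
    using closure_of_iff[OF Lin_subset] by blast
  show "H \<subseteq> norm_topology H nrm closure_of Lin"
  proof
    fix g assume g: "g \<in> H"
    obtain p where p: "p \<in> H" "g - p \<in> norm_topology H nrm closure_of Lin" "\<forall>j\<in>Lin. ip j p = 0"
      using projection[OF Lin_subspace Lin_subset g] by blast
    have "p y = 0" for y
    proof -
      have "K y \<in> Lin" by (auto simp: Lin_def lin_def intro!: exI[of _ "{y}"] exI[of _ "\<lambda>_. 1"])
      then show ?thesis using p ip_K_left[of p y] by simp
    qed
    then have "p = 0" by (auto simp: fun_eq_iff)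
    then show "g \<in> norm_topology H nrm closure_of Lin" using p by simp
  qed
qed

lemma lin_approx_seq:
  assumes "f \<in> H"
  obtains F where "\<And>n. F n \<in> Lin" "(\<lambda>n. nrm (F n - f)) \<longlonglongrightarrow> 0"
proof -
  have "f \<in> norm_topology H nrm closure_of Lin" using assms Lin_dense by simp
  then show ?thesis using that unfolding closure_of_iff_seq[OF Lin_subset]
    by (metis rangeI subsetD)
qed

lemma pointwise_tendsto:
  assumes "\<And>n. F n \<in> H" "f \<in> H" "(\<lambda>n. nrm (F n - f)) \<longlonglongrightarrow> 0"
  shows "(\<lambda>n. F n x) \<longlonglongrightarrow> f x"
  using ip_tendsto_left[OF assms, of "K x"] assms by (simp add: ip_K)

text \<open>Pointwise convergence is convergence against the kernel functions; the uniform norm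
  bound carries it over to their closed span.\<close>

lemma weak_tendsto:
  assumes G: "\<And>n. G n \<in> H" "\<And>n. nrm (G n) \<le> C" and g: "g \<in> H"
    and lim: "\<And>x. (\<lambda>n. G n x) \<longlonglongrightarrow> g x" and w: "w \<in> H"
  shows "(\<lambda>n. ip (G n) w) \<longlonglongrightarrow> ip g w"
proof (rule LIMSEQ_I)
  fix \<epsilon> :: real assume e: "\<epsilon> > 0"
  \<comment> \<open>An upper bound for \<open>nrm (G n - g)\<close>, made positive by the added 1 so
    that one can divide by it.\<close>
  define B where "B = \<bar>C\<bar> + nrm g + 1"
  have B: "B > 0" using g by (simp add: B_def add_nonneg_pos)
  have "w \<in> norm_topology H nrm closure_of Lin" using w Lin_dense by simp
  then obtain v where v: "v \<in> Lin" "nrm (w - v) < \<epsilon> / (2 * B)"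
    unfolding closure_of_iff[OF Lin_subset] using e B by (metis divide_pos_pos mult_pos_pos zero_less_numeral)
  obtain S d where vS: "v = lin S d" using v by (auto simp: Lin_def)
  have "(\<lambda>n. ip (G n) v) \<longlonglongrightarrow> ip g v"
    unfolding vS using G g by (simp add: ip_lin_right) (intro tendsto_intros lim)
  then obtain N where N: "\<And>n. n \<ge> N \<Longrightarrow> cmod (ip (G n) v - ip g v) < \<epsilon> / 2"
    using LIMSEQ_D e half_gt_zero by metis
  have vH: "v \<in> H" using vS by simp
  have "norm (ip (G n) w - ip g w) < \<epsilon>" if "n \<ge> N" for n
  proof -
    have "ip (G n) w - ip g w = (ip (G n) v - ip g v) + ip (G n - g) (w - v)"
      using G g w vH by (simp add: ip_diff ip_diff_right)
    moreover have "cmod (ip (G n - g) (w - v)) \<le> nrm (G n - g) * nrm (w - v)"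
      using G g w vH by (intro cauchy_schwarz) auto
    moreover have "nrm (G n - g) * nrm (w - v) \<le> B * (\<epsilon> / (2 * B))"
    proof (rule mult_mono)
      have "nrm (G n - g) \<le> nrm (G n - 0) + nrm (0 - g)"
        using G g by (intro nrm_triangle_diff) auto
      also have "nrm (0 - g) = nrm (g - 0)" by (rule nrm_diff_commute) (use g in auto)
      finally have "nrm (G n - g) \<le> nrm (G n) + nrm g" by (simp only: diff_0_right)
      then show "nrm (G n - g) \<le> B" using G(2)[of n] unfolding B_def by linarith
    qed (use v B w vH in auto)
    moreover have "B * (\<epsilon> / (2 * B)) = \<epsilon> / 2" using B by simp
    ultimately show ?thesis using N[OF that] norm_triangle_ineq[of "ip (G n) v - ip g v" "ip (G n - g) (w - v)"]
      by simp
  qed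
  then show "\<exists>N. \<forall>n\<ge>N. norm (ip (G n) w - ip g w) < \<epsilon>" by blast
qed

section \<open>Multipliers and their adjoints\<close>

lemma Mult_mem: "\<phi> \<in> Mult H \<Longrightarrow> f \<in> H \<Longrightarrow> \<phi> * f \<in> H"
  by (simp add: Mult_def)

text \<open>Baire's theorem for the sets \<open>A n\<close>: they cover \<open>H\<close>, and each
  is closed because a norm bound on \<open>\<phi> * f\<close> passes to pointwise limits. One of
  them contains a ball, and linearity spreads the bound.\<close>

lemma Mult_bounded:
  assumes phi: "\<phi> \<in> Mult H"
  shows "\<exists>C\<ge>0. \<forall>f\<in>H. nrm (\<phi> * f) \<le> C * nrm f"
proof -
  define A where "A n = {f \<in> H. nrm (\<phi> * f) \<le> real n}" for n
  interpret M: Metric_space H "norm_dist H nrm" by (rule metric)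
  have top: "M.mtopology = norm_topology H nrm" by (simp add: norm_topology_def)
  have AH: "A n \<subseteq> H" for n by (auto simp: A_def)
  have closed: "closedin M.mtopology (A n)" for n
  proof -
    have "norm_topology H nrm closure_of A n \<subseteq> A n"
    proof
      fix f assume "f \<in> norm_topology H nrm closure_of A n"
      then obtain F where f: "f \<in> H" and F: "range F \<subseteq> A n" "(\<lambda>m. nrm (F m - f)) \<longlonglongrightarrow> 0"
        unfolding closure_of_iff_seq[OF AH] by blast
      have FA: "F m \<in> H" "nrm (\<phi> * F m) \<le> real n" for m using F by (auto simp: A_def)
      have "nrm (\<phi> * f) \<le> real n"
      proof (rule pointwise_limit_mem(2)[where G = "\<lambda>m. \<phi> * F m"])
        show "(\<lambda>m. (\<phi> * F m) x) \<longlonglongrightarrow> (\<phi> * f) x" for x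
          using pointwise_tendsto[OF FA(1) f F(2)] by (simp add: tendsto_mult_left)
      qed (use FA Mult_mem[OF phi] in auto)
      then show "f \<in> A n" using f by (simp add: A_def)
    qed
    then show ?thesis using closure_of_subset_eq[of "A n" M.mtopology] AH M.topspace_mtopology
      by (simp add: top)
  qed
  have "\<exists>n. M.mtopology interior_of A n \<noteq> {}"
  proof (rule ccontr)
    assume "\<not> ?thesis"
    then have "M.mtopology interior_of \<Union> (range A) = {}"
      using closed complete by (intro M.metric_Baire_category_alt) auto
    moreover have "\<Union> (range A) = H"
      by (auto simp: A_def intro: real_arch_simple)
    ultimately have "H = {}" using interior_of_topspace[of M.mtopology] M.topspace_mtopology by metis
    then show False using zero_mem by blast
  qed
  then obtain n f0 where "f0 \<in> M.mtopology interior_of A n" by auto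
  then obtain r where f0: "f0 \<in> H" and r: "r > 0" "M.mball f0 r \<subseteq> A n"
    unfolding M.metric_interior_of by auto
  have ball: "nrm (\<phi> * f) \<le> real n" if "f \<in> H" "nrm (f0 - f) < r" for f
    using r that f0 by (auto simp: M.in_mball norm_dist_def A_def subset_iff)
  \<comment> \<open>Moves the ball from \<open>f0\<close> to the origin: \<open>f\<close> is the
    difference of \<open>f0\<close> and \<open>f0 - f\<close>, whose images are both bounded by
    \<open>real n\<close>.\<close>
  have small: "nrm (\<phi> * f) \<le> 2 * real n" if f: "f \<in> H" "nrm f < r" for f
  proof -
    have "\<phi> * f = \<phi> * f0 - \<phi> * (f0 - f)" by (simp add: mult_diff_fun)
    moreover have "nrm (\<phi> * f0 - \<phi> * (f0 - f)) \<le> nrm (\<phi> * f0 - 0) + nrm (0 - \<phi> * (f0 - f))"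
      using f f0 phi by (intro nrm_triangle_diff) (auto intro: Mult_mem)
    moreover have "nrm (0 - \<phi> * (f0 - f)) = nrm (\<phi> * (f0 - f) - 0)"
      using f f0 phi by (intro nrm_diff_commute) (auto intro: Mult_mem)
    moreover have "nrm (\<phi> * f0) \<le> real n" using ball[of f0] f0 r by simp
    moreover have "nrm (\<phi> * (f0 - f)) \<le> real n" using ball[of "f0 - f"] f0 f by simp
    ultimately show ?thesis by simp
  qed
  have "nrm (\<phi> * f) \<le> (4 * real n / r) * nrm f" if f: "f \<in> H" for f
  proof (cases "f = 0")
    case False
    then have nf: "nrm f > 0" using nrm_eq_0_iff[OF f] nrm_nonneg[OF f] by linarith
    \<comment> \<open>Rescales \<open>f\<close> to norm \<open>r / 2\<close>, strictly inside the
      open ball.\<close>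
    define c where "c = complex_of_real (r / (2 * nrm f))"
    have c: "cmod c = r / (2 * nrm f)" using nf r by (simp add: c_def norm_divide norm_mult)
    have "nrm (cscale c f) < r" using f r nf by (simp add: nrm_scale c)
    then have "nrm (\<phi> * cscale c f) \<le> 2 * real n" using f by (intro small) auto
    then have "r / (2 * nrm f) * nrm (\<phi> * f) \<le> 2 * real n"
      using f phi by (simp add: mult_cscale nrm_scale Mult_mem c)
    then show ?thesis using nf r by (simp add: field_simps)
  qed simp
  moreover have "4 * real n / r \<ge> 0" using r by simp
  ultimately show ?thesis by blast
qed

lemma Mult_tendsto:
  assumes phi: "\<phi> \<in> Mult H" and "\<And>n. G n \<in> H" "g \<in> H" "(\<lambda>n. nrm (G n - g)) \<longlonglongrightarrow> 0"
  shows "(\<lambda>n. nrm (\<phi> * G n - \<phi> * g)) \<longlonglongrightarrow> 0"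
proof -
  obtain C where C: "C \<ge> 0" "\<And>f. f \<in> H \<Longrightarrow> nrm (\<phi> * f) \<le> C * nrm f"
    using Mult_bounded[OF phi] by auto
  show ?thesis
  proof (rule tendsto_sandwich[OF _ _ tendsto_const])
    show "\<forall>\<^sub>F n in sequentially. 0 \<le> nrm (\<phi> * G n - \<phi> * g)"
      by (intro always_eventually allI nrm_nonneg diff_mem Mult_mem phi assms)
    show "\<forall>\<^sub>F n in sequentially. nrm (\<phi> * G n - \<phi> * g) \<le> C * nrm (G n - g)"
      using C(2) assms by (intro always_eventually allI) (simp flip: mult_diff_fun)
    show "(\<lambda>n. C * nrm (G n - g)) \<longlonglongrightarrow> 0" using tendsto_mult_left[OF assms(4), of C] by simp
  qed
qed

text \<open>Testing against \<open>K y\<close> forces \<open>v y\<close> to be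
  \<open>ip w (\<phi> * K y)\<close>. This function lies in \<open>H\<close> because multiplication
  by \<open>\<phi>\<close> is bounded, and the identity extends from the kernel span by
  density.\<close>

lemma Mult_adj_ex:
  assumes phi: "\<phi> \<in> Mult H" and w: "w \<in> H"
  shows "\<exists>v\<in>H. \<forall>f\<in>H. ip (\<phi> * f) w = ip f v"
proof -
  obtain C where C: "C \<ge> 0" "\<And>f. f \<in> H \<Longrightarrow> nrm (\<phi> * f) \<le> C * nrm f"
    using Mult_bounded[OF phi] by auto
  define F where "F y = ip w (\<phi> * K y)" for y
  have lin: "(\<Sum>z\<in>S. cnj (d z) * F z) = ip w (\<phi> * lin S d)" for S d
  proof -
    have "\<phi> * lin S d = (\<Sum>z\<in>S. cscale (d z) (\<phi> * K z))"
      by (auto simp: fun_eq_iff lin_apply sum_distrib_left algebra_simps)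
    then show ?thesis using w phi by (simp add: F_def ip_sum_right ip_scale_right Mult_mem)
  qed
  have F: "F \<in> H \<and> nrm F \<le> nrm w * C"
  proof (rule mem_if_bounded_on_lin)
    fix S :: "'x set" and d :: "'x \<Rightarrow> complex"
    have "cmod (ip w (\<phi> * lin S d)) \<le> nrm w * nrm (\<phi> * lin S d)"
      using w phi by (simp add: cauchy_schwarz Mult_mem)
    also have "\<dots> \<le> nrm w * (C * nrm (lin S d))" using w C by (intro mult_left_mono) auto
    finally show "cmod (\<Sum>z\<in>S. cnj (d z) * F z) \<le> nrm w * C * nrm (lin S d)"
      by (simp add: lin mult.assoc)
  qed (use w C in auto)
  have "ip (\<phi> * f) w = ip f F" if f: "f \<in> H" for f
  proof -
    obtain G where G: "\<And>n. G n \<in> Lin" "(\<lambda>n. nrm (G n - f)) \<longlonglongrightarrow> 0"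
      using lin_approx_seq[OF f] by blast
    have GH: "G n \<in> H" for n using G Lin_subset by auto
    have eq: "ip (\<phi> * G n) w = ip (G n) F" for n
    proof -
      obtain S d where "G n = lin S d" using G(1)[of n] by (auto simp: Lin_def)
      then have "ip F (G n) = ip w (\<phi> * G n)" using F by (simp add: ip_lin_right lin)
      then show ?thesis
        using ip_cnj[of F "G n"] ip_cnj[of w "\<phi> * G n"] F w GH phi by (simp add: Mult_mem)
    qed
    have "(\<lambda>n. nrm (\<phi> * G n - \<phi> * f)) \<longlonglongrightarrow> 0"
      by (rule Mult_tendsto[OF phi GH f G(2)])
    then have "(\<lambda>n. ip (\<phi> * G n) w) \<longlonglongrightarrow> ip (\<phi> * f) w"
      by (intro ip_tendsto_left Mult_mem phi GH f w)
    moreover have "(\<lambda>n. ip (G n) F) \<longlonglongrightarrow> ip f F"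
      using F by (intro ip_tendsto_left GH f G) auto
    ultimately show ?thesis by (simp add: eq LIMSEQ_unique)
  qed
  then show ?thesis using F by blast
qed

lemma ip_right_unique:
  assumes D: "D \<subseteq> H" "norm_topology H nrm closure_of D = H"
    and "v \<in> H" "w \<in> H" "\<And>f. f \<in> D \<Longrightarrow> ip f v = ip f w"
  shows "v = w"
proof -
  have "ip f (v - w) = 0" if "f \<in> D" for f
    using assms that ip_diff_right[of v w f] by auto
  then have "v - w = 0"
    using D assms by (intro eq_0_if_orthogonal_dense[of D]) auto
  then show ?thesis by simp
qed

lemma closure_of_whole: "norm_topology H nrm closure_of H = H"
  using closure_of_iff_seq[of H] by (force intro: exI[of _ "\<lambda>_. _"])

lemma Mult_adj:
  assumes phi: "\<phi> \<in> Mult H" and w: "w \<in> H"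
  shows "Mult_adj H ip \<phi> w \<in> H" and "f \<in> H \<Longrightarrow> ip (\<phi> * f) w = ip f (Mult_adj H ip \<phi> w)"
proof -
  obtain v where v: "v \<in> H" "\<forall>f\<in>H. ip (\<phi> * f) w = ip f v" using Mult_adj_ex[OF assms] by blast
  have "Mult_adj H ip \<phi> w \<in> H \<and> (\<forall>f\<in>H. ip (\<phi> * f) w = ip f (Mult_adj H ip \<phi> w))"
    unfolding Mult_adj_def adj_def
  proof (rule theI[of _ v])
    show "z = v" if "z \<in> H \<and> (\<forall>f\<in>H. ip (\<phi> * f) w = ip f z)" for z
      using that v by (intro ip_right_unique[OF subset_refl closure_of_whole]) auto
  qed (use v in blast)
  then show "Mult_adj H ip \<phi> w \<in> H" "f \<in> H \<Longrightarrow> ip (\<phi> * f) w = ip f (Mult_adj H ip \<phi> w)"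
    by auto
qed

text \<open>On kernel functions, the adjoint of multiplication by \<open>\<phi>\<close> acts by \<open>K z \<mapsto> cnj (\<phi> z) K z\<close>.\<close>

lemma Mult_if_bounded_on_lin:
  assumes bound: "\<And>S d. finite S \<Longrightarrow> nrm (lin S (\<lambda>z. cnj (\<phi> z) * d z)) \<le> C * nrm (lin S d)"
    and C: "C \<ge> 0"
  shows "\<phi> \<in> Mult H" and "g \<in> H \<Longrightarrow> nrm (\<phi> * g) \<le> C * nrm g"
proof -
  have *: "\<phi> * g \<in> H \<and> nrm (\<phi> * g) \<le> C * nrm g" if g: "g \<in> H" for g
  proof (rule mem_if_bounded_on_lin)
    fix S :: "'x set" and d :: "'x \<Rightarrow> complex" assume S: "finite S"
    have "(\<Sum>z\<in>S. cnj (d z) * (\<phi> * g) z) = ip g (lin S (\<lambda>z. cnj (\<phi> z) * d z))"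
      using g by (simp add: ip_lin_right algebra_simps)
    also have "cmod \<dots> \<le> nrm g * nrm (lin S (\<lambda>z. cnj (\<phi> z) * d z))"
      using g by (simp add: cauchy_schwarz)
    also have "\<dots> \<le> nrm g * (C * nrm (lin S d))"
      using bound[OF S] g by (intro mult_left_mono) auto
    finally show "cmod (\<Sum>z\<in>S. cnj (d z) * (\<phi> * g) z) \<le> C * nrm g * nrm (lin S d)"
      by (simp add: algebra_simps)
  qed (use C g in auto)
  then show "\<phi> \<in> Mult H" by (simp add: Mult_def)
  show "g \<in> H \<Longrightarrow> nrm (\<phi> * g) \<le> C * nrm g" using * by auto
qed

lemma Mult_zero: "0 \<in> Mult H"
  by (simp add: Mult_def)

lemma Mult_add: "\<phi> \<in> Mult H \<Longrightarrow> \<psi> \<in> Mult H \<Longrightarrow> \<phi> + \<psi> \<in> Mult H"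
  by (simp add: Mult_def distrib_right)

lemma Mult_scale: "\<phi> \<in> Mult H \<Longrightarrow> cscale c \<phi> \<in> Mult H"
proof -
  have "cscale c \<phi> * f = cscale c (\<phi> * f)" for f by (auto simp: fun_eq_iff)
  then show "\<phi> \<in> Mult H \<Longrightarrow> cscale c \<phi> \<in> Mult H" by (simp add: Mult_def)
qed

lemma Mult_sum: "(\<And>i. i \<in> I \<Longrightarrow> F i \<in> Mult H) \<Longrightarrow> (\<Sum>i\<in>I. F i) \<in> Mult H"
  by (induction I rule: infinite_finite_induct) (auto simp: Mult_zero Mult_add)

lemma Mult_adj_eqI:
  assumes "\<phi> \<in> Mult H" "w \<in> H" "v \<in> H" "\<And>f. f \<in> H \<Longrightarrow> ip (\<phi> * f) w = ip f v"
  shows "Mult_adj H ip \<phi> w = v"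
  by (rule ip_right_unique[OF subset_refl closure_of_whole])
    (use assms Mult_adj[OF assms(1,2)] in auto)

lemma Mult_adj_diff:
  assumes "\<phi> \<in> Mult H" "w \<in> H" "v \<in> H"
  shows "Mult_adj H ip \<phi> (w - v) = Mult_adj H ip \<phi> w - Mult_adj H ip \<phi> v"
  using assms
  by (intro Mult_adj_eqI) (auto simp: Mult_adj Mult_mem ip_diff_right)

lemma Mult_adj_bounded:
  assumes phi: "\<phi> \<in> Mult H"
  shows "\<exists>C\<ge>0. \<forall>w\<in>H. nrm (Mult_adj H ip \<phi> w) \<le> C * nrm w"
proof -
  obtain C where C: "C \<ge> 0" "\<And>f. f \<in> H \<Longrightarrow> nrm (\<phi> * f) \<le> C * nrm f"
    using Mult_bounded[OF phi] by auto
  have "nrm (Mult_adj H ip \<phi> w) \<le> C * nrm w" if w: "w \<in> H" for w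
  proof -
    define v where "v = Mult_adj H ip \<phi> w"
    have v: "v \<in> H" using Mult_adj(1)[OF phi w] by (simp add: v_def)
    have "nrm v * nrm v = Re (ip v v)" using Re_ip_self[OF v] by (simp add: power2_eq_square)
    also have "ip v v = ip (\<phi> * v) w" using Mult_adj(2)[OF phi w v] by (simp add: v_def)
    also have "Re \<dots> \<le> nrm (\<phi> * v) * nrm w"
      using cauchy_schwarz[OF Mult_mem[OF phi v] w] complex_Re_le_cmod order_trans by blast
    also have "\<dots> \<le> (C * nrm v) * nrm w" using C v w by (intro mult_right_mono) auto
    finally have le: "nrm v * nrm v \<le> nrm v * (C * nrm w)" by (simp add: algebra_simps)
    show "nrm v \<le> C * nrm w"
    proof (cases "nrm v = 0")
      case False
      then have "nrm v > 0" using nrm_nonneg[OF v] by linarith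
      then show ?thesis using le by (rule mult_left_le_imp_le[rotated])
    qed (use C w in simp)
  qed
  then show ?thesis using C by blast
qed

lemma Mult_adj_tendsto:
  assumes phi: "\<phi> \<in> Mult H" and G: "\<And>n. G n \<in> H" and g: "g \<in> H" and l: "(\<lambda>n. nrm (G n - g)) \<longlonglongrightarrow> 0"
  shows "(\<lambda>n. nrm (Mult_adj H ip \<phi> (G n) - Mult_adj H ip \<phi> g)) \<longlonglongrightarrow> 0"
proof -
  obtain C where C: "C \<ge> 0" "\<And>f. f \<in> H \<Longrightarrow> nrm (Mult_adj H ip \<phi> f) \<le> C * nrm f"
    using Mult_adj_bounded[OF phi] by auto
  show ?thesis
  proof (rule tendsto_sandwich[OF _ _ tendsto_const])
    show "\<forall>\<^sub>F n in sequentially. 0 \<le> nrm (Mult_adj H ip \<phi> (G n) - Mult_adj H ip \<phi> g)"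
      by (intro always_eventually allI nrm_nonneg diff_mem Mult_adj(1) phi G g)
    show "\<forall>\<^sub>F n in sequentially. nrm (Mult_adj H ip \<phi> (G n) - Mult_adj H ip \<phi> g) \<le> C * nrm (G n - g)"
    proof (intro always_eventually allI)
      show "nrm (Mult_adj H ip \<phi> (G n) - Mult_adj H ip \<phi> g) \<le> C * nrm (G n - g)" for n
        unfolding Mult_adj_diff[OF phi G g, symmetric] by (intro C(2) diff_mem G g)
    qed
    show "(\<lambda>n. C * nrm (G n - g)) \<longlonglongrightarrow> 0" using tendsto_mult_left[OF l, of C] by simp
  qed
qed

lemma star_invariant_closure:
  assumes J: "J \<subseteq> H" "star_invariant H ip J"
  shows "star_invariant H ip (norm_topology H nrm closure_of J)"
  unfolding star_invariant_def
proof (intro ballI subsetI)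
  fix \<phi> v assume phi: "\<phi> \<in> Mult H" and "v \<in> Mult_adj H ip \<phi> ` (norm_topology H nrm closure_of J)"
  then obtain g where v: "v = Mult_adj H ip \<phi> g" and "g \<in> norm_topology H nrm closure_of J" by blast
  then obtain F where g: "g \<in> H" and F: "range F \<subseteq> J" "(\<lambda>n. nrm (F n - g)) \<longlonglongrightarrow> 0"
    unfolding closure_of_iff_seq[OF J(1)] by blast
  have FJ: "F n \<in> J" "F n \<in> H" for n using F J by auto
  have "range (\<lambda>n. Mult_adj H ip \<phi> (F n)) \<subseteq> J"
    using J(2) phi FJ by (auto simp: star_invariant_def)
  moreover have "(\<lambda>n. nrm (Mult_adj H ip \<phi> (F n) - v)) \<longlonglongrightarrow> 0"
    unfolding v by (intro Mult_adj_tendsto phi FJ g F)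
  moreover have "v \<in> H" unfolding v by (intro Mult_adj(1) phi g)
  ultimately show "v \<in> norm_topology H nrm closure_of J"
    unfolding closure_of_iff_seq[OF J(1)] by (intro conjI exI[of _ "\<lambda>n. Mult_adj H ip \<phi> (F n)"])
qed

end

section \<open>Positive semidefinite kernels\<close>

text \<open>Constraining the real part of the form spares separate proofs of Hermitian symmetry. The
  property is kept by sums, pointwise limits and rescaling of the coefficients, from which the
  product rules below are built.\<close>

definition psd :: "('j \<Rightarrow> 'j \<Rightarrow> complex) \<Rightarrow> bool"
  where "psd M \<longleftrightarrow> (\<forall>S c. finite S \<longrightarrow> 0 \<le> Re (\<Sum>x\<in>S. \<Sum>y\<in>S. cnj (c x) * c y * M x y))"

lemma psdD: "psd M \<Longrightarrow> finite S \<Longrightarrow> 0 \<le> Re (\<Sum>x\<in>S. \<Sum>y\<in>S. cnj (c x) * c y * M x y)"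
  by (simp add: psd_def)

lemma psd_add: "psd M \<Longrightarrow> psd N \<Longrightarrow> psd (\<lambda>x y. M x y + N x y)"
  by (simp add: psd_def distrib_left sum.distrib)

lemma psd_cmult: "psd M \<Longrightarrow> 0 \<le> r \<Longrightarrow> psd (\<lambda>x y. of_real r * M x y)"
  for M :: "'j \<Rightarrow> 'j \<Rightarrow> complex"
proof -
  have "(\<Sum>x\<in>S. \<Sum>y\<in>S. cnj (c x) * c y * (of_real r * M x y)) =
      of_real r * (\<Sum>x\<in>S. \<Sum>y\<in>S. cnj (c x) * c y * M x y)" for c and S :: "'j set"
    by (simp add: sum_distrib_left algebra_simps)
  then show "psd M \<Longrightarrow> 0 \<le> r \<Longrightarrow> psd (\<lambda>x y. of_real r * M x y)"
    by (simp add: psd_def del: Re_sum)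
qed

lemma psd_limit:
  fixes M :: "nat \<Rightarrow> 'a \<Rightarrow> 'a \<Rightarrow> complex"
  assumes "\<And>n. psd (M n)" "\<And>x y. (\<lambda>n. M n x y) \<longlonglongrightarrow> N x y"
  shows "psd N"
  unfolding psd_def
proof (intro allI impI)
  fix S :: "'a set" and c :: "'a \<Rightarrow> complex" assume S: "finite S"
  have l: "(\<lambda>n. Re (\<Sum>x\<in>S. \<Sum>y\<in>S. cnj (c x) * c y * M n x y)) \<longlonglongrightarrow>
      Re (\<Sum>x\<in>S. \<Sum>y\<in>S. cnj (c x) * c y * N x y)"
    by (intro tendsto_intros assms)
  show "0 \<le> Re (\<Sum>x\<in>S. \<Sum>y\<in>S. cnj (c x) * c y * N x y)"
    by (rule Lim_bounded2[OF l]) (use psdD[OF assms(1) S] in blast)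
qed

lemma psd_one: "psd (\<lambda>x y. 1)"
proof -
  have "(\<Sum>x\<in>S. \<Sum>y\<in>S. cnj (c x) * c y * 1) = of_real ((cmod (\<Sum>x\<in>S. c x))\<^sup>2)"
    for c :: "'a \<Rightarrow> complex" and S
    unfolding complex_norm_square
    by (simp add: sum_distrib_left sum_distrib_right mult.commute)
  then show ?thesis by (simp add: psd_def del: Re_sum)
qed

lemma (in hilbert_function_space) gram_sum:
  assumes "\<And>x. x \<in> S \<Longrightarrow> \<alpha> x \<in> H"
  shows "(\<Sum>x\<in>S. \<Sum>y\<in>S. cnj (c x) * c y * ip (\<alpha> y) (\<alpha> x)) =
    ip (\<Sum>y\<in>S. cscale (c y) (\<alpha> y)) (\<Sum>x\<in>S. cscale (c x) (\<alpha> x))"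
  using assms
  by (simp add: ip_sum ip_sum_right ip_scale ip_scale_right sum_mem sum_distrib_left mult.commute mult.left_commute)

lemma (in hilbert_function_space) psd_gram:
  assumes "\<And>x. \<alpha> x \<in> H"
  shows "psd (\<lambda>x y. ip (\<alpha> y) (\<alpha> x))"
  unfolding psd_def gram_sum[OF assms] using assms
  by (auto intro!: Re_ip_nonneg sum_mem)

section \<open>Square summable families and Schur products\<close>

lemma has_sum_finite_sum:
  fixes f :: "'a \<Rightarrow> 'b \<Rightarrow> complex"
  assumes "\<And>x. x \<in> S \<Longrightarrow> (f x has_sum g x) A"
  shows "((\<lambda>i. \<Sum>x\<in>S. f x i) has_sum (\<Sum>x\<in>S. g x)) A"
  using assms by (induction S rule: infinite_finite_induct) (auto intro: has_sum_add)

lemma ell2_norm_nonneg: "0 \<le> ell2_norm a"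
  unfolding ell2_norm_def by (intro real_sqrt_ge_zero infsum_nonneg) simp

lemma ell2_norm_has_sum:
  assumes "a \<in> ell2"
  shows "((\<lambda>i. (cmod (a i))\<^sup>2) has_sum (ell2_norm a)\<^sup>2) UNIV"
proof -
  have "(ell2_norm a)\<^sup>2 = (\<Sum>\<^sub>\<infinity>i. (cmod (a i))\<^sup>2)"
    unfolding ell2_norm_def by (intro real_sqrt_pow2 infsum_nonneg) simp
  moreover have "(\<lambda>i. (cmod (a i))\<^sup>2) summable_on UNIV" using assms unfolding ell2_def by blast
  ultimately show ?thesis by (metis has_sum_infsum)
qed

lemma mult_le_half_sum_squares: "x * y \<le> (x\<^sup>2 + y\<^sup>2) * (1 / 2)" for x y :: real
proof -
  have "0 \<le> (x - y)\<^sup>2" by simp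
  also have "\<dots> = (x\<^sup>2 + y\<^sup>2) - 2 * (x * y)" by (simp add: power2_diff)
  finally show ?thesis by simp
qed

lemma ell2_bound_has_sum:
  assumes "a \<in> ell2" "b \<in> ell2"
  shows "((\<lambda>i. ((cmod (a i))\<^sup>2 + (cmod (b i))\<^sup>2) * (1 / 2)) has_sum
    ((ell2_norm a)\<^sup>2 + (ell2_norm b)\<^sup>2) * (1 / 2)) UNIV"
  by (rule has_sum_cmult_left[OF has_sum_add[OF ell2_norm_has_sum ell2_norm_has_sum, OF assms]])

lemma norm_mult_cnj_le: "norm (x * cnj y) \<le> ((cmod x)\<^sup>2 + (cmod y)\<^sup>2) * (1 / 2)"
  unfolding norm_mult complex_mod_cnj by (rule mult_le_half_sum_squares)

lemma ell2_has_sum: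
  assumes "a \<in> ell2" "b \<in> ell2"
  shows "((\<lambda>i. a i * cnj (b i)) has_sum ell2_inner a b) UNIV"
proof -
  have "(\<lambda>i. norm (a i * cnj (b i))) summable_on UNIV"
    by (rule summable_on_comparison_test[OF has_sum_imp_summable[OF ell2_bound_has_sum[OF assms]]])
      (rule norm_mult_cnj_le norm_ge_zero)+
  then show ?thesis
    unfolding ell2_inner_def by (rule has_sum_infsum[OF abs_summable_summable])
qed

text \<open>The arithmetic mean in place of the product of the norms is good enough: when both norms
  are below 1, so is the bound.\<close>

lemma ell2_inner_bound:
  assumes "a \<in> ell2" "b \<in> ell2"
  shows "cmod (ell2_inner a b) \<le> ((ell2_norm a)\<^sup>2 + (ell2_norm b)\<^sup>2) * (1 / 2)"
  by (rule norm_infsum_le[OF ell2_has_sum[OF assms] ell2_bound_has_sum[OF assms] norm_mult_cnj_le])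

text \<open>A Schur product, taken one coordinate at a time: the factor
  \<open>u x i * cnj (u y i)\<close> is absorbed into the coefficients \<open>c\<close>, and the
  nonnegative contributions are summed over \<open>i\<close>.\<close>

lemma psd_ell2_mult:
  fixes u :: "'a \<Rightarrow> 'i \<Rightarrow> complex"
  assumes u: "\<And>x. u x \<in> ell2" and M: "psd M"
  shows "psd (\<lambda>x y. ell2_inner (u x) (u y) * M x y)"
  unfolding psd_def
proof (intro allI impI)
  fix S :: "'a set" and c :: "'a \<Rightarrow> complex" assume S: "finite S"
  have "((\<lambda>i. \<Sum>x\<in>S. \<Sum>y\<in>S. cnj (c x) * c y * (u x i * cnj (u y i) * M x y)) has_sum
      (\<Sum>x\<in>S. \<Sum>y\<in>S. cnj (c x) * c y * (ell2_inner (u x) (u y) * M x y))) UNIV"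
    by (intro has_sum_finite_sum has_sum_cmult_right has_sum_cmult_left ell2_has_sum u)
  then have hs: "((\<lambda>i. Re (\<Sum>x\<in>S. \<Sum>y\<in>S. cnj (c x) * c y * (u x i * cnj (u y i) * M x y))) has_sum
      Re (\<Sum>x\<in>S. \<Sum>y\<in>S. cnj (c x) * c y * (ell2_inner (u x) (u y) * M x y))) UNIV"
    by (rule has_sum_Re)
  show "0 \<le> Re (\<Sum>x\<in>S. \<Sum>y\<in>S. cnj (c x) * c y * (ell2_inner (u x) (u y) * M x y))"
  proof (rule has_sum_nonneg[OF hs])
    fix i
    have "(\<Sum>x\<in>S. \<Sum>y\<in>S. cnj (c x) * c y * (u x i * cnj (u y i) * M x y)) =
        (\<Sum>x\<in>S. \<Sum>y\<in>S. cnj (c x * cnj (u x i)) * (c y * cnj (u y i)) * M x y)"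
      by (simp add: algebra_simps)
    then show "0 \<le> Re (\<Sum>x\<in>S. \<Sum>y\<in>S. cnj (c x) * c y * (u x i * cnj (u y i) * M x y))"
      using psdD[OF M S, of "\<lambda>x. c x * cnj (u x i)"] by (simp only:)
  qed
qed

section \<open>Complete Nevanlinna-Pick kernels\<close>

locale cnp = rkhs H ip k
  for H :: "('x \<Rightarrow> complex) set" and ip :: "'x cinner" and k +
  fixes u :: "'x \<Rightarrow> 'i \<Rightarrow> complex"
  assumes cnp: "cnp_kernel u k"
begin

section \<open>The kernel as a geometric series\<close>

definition b :: "'x \<Rightarrow> 'x \<Rightarrow> complex"
  where "b x y = ell2_inner (u x) (u y)"

lemma u_ell2: "u x \<in> ell2" and u_norm: "ell2_norm (u x) < 1" and k_eq: "k x y = 1 / (1 - b x y)"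
  using cnp unfolding cnp_kernel_def b_def by blast+

lemma norm_b: "cmod (b x y) < 1"
proof -
  have sq: "(ell2_norm (u z))\<^sup>2 < 1" for z
    using mult_strict_mono[OF u_norm u_norm, of z z] ell2_norm_nonneg[of "u z"]
    by (simp add: power2_eq_square)
  have "cmod (b x y) \<le> ((ell2_norm (u x))\<^sup>2 + (ell2_norm (u y))\<^sup>2) * (1 / 2)"
    unfolding b_def by (rule ell2_inner_bound[OF u_ell2 u_ell2])
  moreover have "a < 1" if "a \<le> (p + q) * (1 / 2)" "p < 1" "q < 1" for a p q :: real
    using that by argo
  ultimately show ?thesis using sq by blast
qed

lemma k_nz: "1 - b x y \<noteq> 0" "k x y \<noteq> 0"
proof -
  have "b x y \<noteq> 1" using norm_b[of x y] by (metis norm_one less_irrefl)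
  then show "1 - b x y \<noteq> 0" by simp
  then show "k x y \<noteq> 0" by (simp add: k_eq)
qed

lemma k_rec: "k x y = 1 + b x y * k x y"
  using k_nz(1)[of x y] by (simp add: k_eq divide_simps)

lemma k_cnj: "k y x = cnj (k x y)"
  using ip_cnj[OF K_mem K_mem, of x y] unfolding ip_K[OF K_mem] .

lemma b_cnj: "b y x = cnj (b x y)"
  unfolding b_def ell2_inner_def by (subst infsum_cnj[symmetric]) (simp add: mult.commute)

lemma psd_b_mult: "psd M \<Longrightarrow> psd (\<lambda>x y. b x y * M x y)"
  unfolding b_def by (rule psd_ell2_mult[OF u_ell2])

text \<open>\<open>k\<close> is the geometric series in \<open>b\<close>, and multiplication by each
  power of \<open>b\<close> preserves positivity. The series converges because \<open>b\<close> has
  modulus below 1.\<close>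

lemma psd_k_mult:
  assumes M: "psd M"
  shows "psd (\<lambda>x y. k x y * M x y)"
proof (rule psd_limit)
  have pow: "psd (\<lambda>x y. b x y ^ n * M x y)" for n
    by (induction n) (use M psd_b_mult in \<open>auto simp: mult.assoc\<close>)
  show "psd (\<lambda>x y. (\<Sum>n<N. b x y ^ n) * M x y)" for N
  proof (induction N)
    case 0
    then show ?case by (simp add: psd_def)
  next
    case (Suc N)
    then show ?case using psd_add[OF Suc pow[of N]] by (simp add: distrib_right)
  qed
  show "(\<lambda>N. (\<Sum>n<N. b x y ^ n) * M x y) \<longlonglongrightarrow> k x y * M x y" for x y
    using geometric_sums[OF norm_b, of x y] unfolding sums_def k_eq
    by (intro tendsto_mult_right) simp
qed

lemma psd_k: "psd k"
  using psd_k_mult[OF psd_one] by simp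

text \<open>Because \<open>b * k = k - 1\<close>, the two forms differ by that of the constant
  kernel 1, a squared modulus. It is subtracted, so it may be dropped in upper bounds; this is how
  \<open>b * k\<close> gets replaced by \<open>k\<close>.\<close>

lemma bk_quadratic:
  "(\<Sum>x\<in>S. \<Sum>y\<in>S. cnj (c x) * c y * (b x y * k x y)) =
    (\<Sum>x\<in>S. \<Sum>y\<in>S. cnj (c x) * c y * k x y) - of_real ((cmod (\<Sum>x\<in>S. c x))\<^sup>2)"
proof -
  have "b x y * k x y = k x y - 1" for x y by (metis k_rec add_diff_cancel_left')
  moreover have "(\<Sum>x\<in>S. \<Sum>y\<in>S. cnj (c x) * c y) = of_real ((cmod (\<Sum>x\<in>S. c x))\<^sup>2)"
    unfolding complex_norm_square
    by (simp add: sum_distrib_left sum_distrib_right mult.commute)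
  ultimately show ?thesis by (simp add: right_diff_distrib sum_subtractf)
qed

text \<open>With \<open>s\<close> at least the squared norm of \<open>u y\<close>, this is the
  Cauchy-Schwarz inequality for \<open>u y\<close> and a combination of the \<open>u z\<close>.
  Having \<open>s\<close> strictly below 1 makes multiplication by \<open>b z y\<close> in the
  variable \<open>z\<close> a strict contraction.\<close>

lemma psd_b_diff:
  "\<exists>s. 0 < s \<and> s < 1 \<and> psd (\<lambda>z w. of_real s * b z w - b z y * b y w)"
proof -
  define n where "n = Re (b y y)"
  have byy: "b y y = of_real n" using b_cnj[of y y] by (simp add: n_def complex_eq_iff)
  \<comment> \<open>The midpoint between the squared norm \<open>n\<close> of \<open>u y\<close> and
    1. It is positive even if \<open>u y\<close> vanishes, so one may divide by it.\<close>
  define s where "s = (1 + n) / 2"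
  have n1: "n < 1" using norm_b[of y y] by (simp add: byy)
  have n0: "0 \<le> n"
    using psdD[OF psd_b_mult[OF psd_one], of "{y}" "\<lambda>_. 1"] by (simp add: n_def)
  have s: "0 < s" "s < 1" "n \<le> s" using n0 n1 by (auto simp: s_def)
  have "psd (\<lambda>z w. of_real s * b z w - b z y * b y w)"
    unfolding psd_def
  proof (intro allI impI)
    fix S :: "'x set" and c :: "'x \<Rightarrow> complex" assume S: "finite S"
    define p where "p = (\<Sum>z\<in>S. cnj (c z) * b z y)"
    define q where "q = (\<Sum>z\<in>S. \<Sum>w\<in>S. cnj (c z) * c w * b z w)"
    define p2 where "p2 = (\<Sum>z\<in>S. c z * b y z)"
    have p': "p2 = cnj p" by (simp add: p_def p2_def flip: b_cnj)
    \<comment> \<open>Completing the square would call for \<open>- p / n\<close>, but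
      \<open>n\<close> may be 0; \<open>s\<close> in its place loses nothing that matters, as
      \<open>n \<le> s\<close>.\<close>
    define t where "t = - p / s"
    \<comment> \<open>The index \<open>None\<close> is an additional copy of the point
      \<open>y\<close>, which may already belong to \<open>S\<close> and has to receive a
      coefficient of its own.\<close>
    define u' where "u' = case_option (u y) u"
    define c' where "c' = case_option (cnj t) c"
    have u': "u' x \<in> ell2" for x by (cases x) (auto simp: u'_def u_ell2)
    have "0 \<le> Re (\<Sum>x\<in>insert None (Some ` S). \<Sum>y\<in>insert None (Some ` S).
        cnj (c' x) * c' y * (ell2_inner (u' x) (u' y) * 1))"
      using S by (intro psdD psd_ell2_mult u' psd_one) auto
    also have "(\<Sum>x\<in>insert None (Some ` S). \<Sum>y\<in>insert None (Some ` S).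
        cnj (c' x) * c' y * (ell2_inner (u' x) (u' y) * 1)) =
        t * cnj t * n + t * p2 + cnj t * p + q"
      using S
      by (simp add: sum.reindex c'_def u'_def b_def[symmetric] byy sum.distrib p2_def p_def q_def
          sum_distrib_left algebra_simps)
    also have "t * cnj t * n + t * p2 + cnj t * p + q = t * cnj t * n + t * cnj p + cnj t * p + q"
      by (simp add: p')
    also have "Re (t * cnj t * n + t * cnj p + cnj t * p + q) =
        (cmod p)\<^sup>2 * (n / s\<^sup>2) - 2 * (cmod p)\<^sup>2 / s + Re q"
    proof -
      have "t * cnj t * n = (p * cnj p) * of_real (n / s\<^sup>2)"
        by (simp add: t_def power2_eq_square)
      then have "t * cnj t * n = of_real ((cmod p)\<^sup>2 * (n / s\<^sup>2))"
        by (simp flip: complex_norm_square)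
      moreover have "t * cnj p = of_real (- (cmod p)\<^sup>2 / s)" "cnj t * p = of_real (- (cmod p)\<^sup>2 / s)"
        by (simp_all add: t_def complex_norm_square mult.commute del: of_real_power)
      ultimately show ?thesis by simp
    qed
    also have "(cmod p)\<^sup>2 * (n / s\<^sup>2) \<le> (cmod p)\<^sup>2 * (1 / s)"
      using s by (intro mult_left_mono) (auto simp: power2_eq_square field_simps)
    finally have "0 \<le> Re q - (cmod p)\<^sup>2 / s" by (simp add: algebra_simps)
    then have ge: "0 \<le> s * Re q - (cmod p)\<^sup>2" using s by (simp add: field_simps)
    have "(\<Sum>z\<in>S. \<Sum>w\<in>S. cnj (c z) * c w * (of_real s * b z w - b z y * b y w)) =
        of_real s * q - p * cnj p"
      unfolding p'[symmetric] unfolding p_def p2_def q_def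
      by (simp add: sum_distrib_left sum_distrib_right sum_subtractf algebra_simps sum_product)
    then show "0 \<le> Re (\<Sum>z\<in>S. \<Sum>w\<in>S. cnj (c z) * c w * (of_real s * b z w - b z y * b y w))"
      using ge by (simp flip: complex_norm_square del: Re_sum)
  qed
  then show ?thesis using s by blast
qed

text \<open>\<open>K y\<close> is the inverse of \<open>1 - b z y\<close> as a function of
  \<open>z\<close>, and multiplication by \<open>b z y\<close> has norm at most
  \<open>sqrt s\<close>, below 1. The inverse is an explicit function, so an a priori estimate can
  take the place of a Neumann series.\<close>

lemma K_Mult: "K y \<in> Mult H"
proof -
  obtain s where s: "0 < s" "s < 1" and psd: "psd (\<lambda>z w. of_real s * b z w - b z y * b y w)"
    using psd_b_diff by blast
  \<comment> \<open>The adjoint form of the contraction: the positive kernel of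
    \<open>psd_b_diff\<close> is multiplied by \<open>k\<close>, which turns its two terms into
    squared norms of kernel combinations, up to a dropped square.\<close>
  have contr: "nrm (lin S (\<lambda>z. cnj (b z y) * e z)) \<le> sqrt s * nrm (lin S e)" if S: "finite S" for S e
  proof -
    have "0 \<le> Re (\<Sum>x\<in>S. \<Sum>w\<in>S. cnj (e x) * e w * (k x w * (of_real s * b x w - b x y * b y w)))"
      by (intro psdD psd_k_mult psd S)
    also have "(\<Sum>x\<in>S. \<Sum>w\<in>S. cnj (e x) * e w * (k x w * (of_real s * b x w - b x y * b y w))) =
        of_real s * (\<Sum>x\<in>S. \<Sum>w\<in>S. cnj (e x) * e w * (b x w * k x w)) -
        (\<Sum>x\<in>S. \<Sum>w\<in>S. cnj (cnj (b x y) * e x) * (cnj (b w y) * e w) * k x w)"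
      by (simp add: sum_distrib_left sum_subtractf algebra_simps flip: b_cnj)
    also have "Re \<dots> = s * ((nrm (lin S e))\<^sup>2 - (cmod (\<Sum>x\<in>S. e x))\<^sup>2) -
        (nrm (lin S (\<lambda>z. cnj (b z y) * e z)))\<^sup>2"
      unfolding nrm_lin_sq bk_quadratic by (simp del: Re_sum)
    finally have "(nrm (lin S (\<lambda>z. cnj (b z y) * e z)))\<^sup>2 \<le>
        s * (nrm (lin S e))\<^sup>2 - s * (cmod (\<Sum>x\<in>S. e x))\<^sup>2"
      by (simp add: algebra_simps)
    also have "\<dots> \<le> (sqrt s * nrm (lin S e))\<^sup>2"
      using s by (simp add: power_mult_distrib)
    finally show ?thesis by (rule power2_le_imp_le) (use s in simp)
  qed
  show ?thesis
  proof (rule Mult_if_bounded_on_lin)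
    fix S :: "'x set" and d :: "'x \<Rightarrow> complex" assume S: "finite S"
    \<comment> \<open>The coefficients after applying the adjoint of multiplication by
      \<open>K y\<close>. By \<open>k_rec\<close> they solve
      \<open>d z = e z - cnj (b z y) * e z\<close>, so the contraction bounds \<open>e\<close> in
      terms of \<open>d\<close>.\<close>
    define e where "e z = cnj (k z y) * d z" for z
    have "d z = e z - cnj (b z y) * e z" for z
    proof -
      have "cnj (k z y) = 1 + cnj (b z y) * cnj (k z y)"
        by (metis k_rec complex_cnj_add complex_cnj_mult complex_cnj_one)
      then have "cnj (k z y) - cnj (b z y) * cnj (k z y) = 1" unfolding diff_eq_eq .
      moreover have "e z - cnj (b z y) * e z = (cnj (k z y) - cnj (b z y) * cnj (k z y)) * d z"
        by (simp add: e_def algebra_simps)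
      ultimately show ?thesis by simp
    qed
    then have "lin S e = lin S (\<lambda>z. d z + cnj (b z y) * e z)"
      by (intro arg_cong[where f = "lin S"] ext) (metis diff_add_cancel)
    then have "lin S e = lin S d + lin S (\<lambda>z. cnj (b z y) * e z)"
      by (simp only: lin_plus)
    then have "nrm (lin S e) \<le> nrm (lin S d) + nrm (lin S (\<lambda>z. cnj (b z y) * e z))"
      by (simp add: nrm_triangle)
    also have "\<dots> \<le> nrm (lin S d) + sqrt s * nrm (lin S e)" using contr[OF S] by simp
    finally have "(1 - sqrt s) * nrm (lin S e) \<le> nrm (lin S d)" by (simp add: algebra_simps)
    then have "nrm (lin S e) \<le> 1 / (1 - sqrt s) * nrm (lin S d)"
      using s by (simp add: field_simps)
    then show "nrm (lin S (\<lambda>z. cnj (k z y) * d z)) \<le> 1 / (1 - sqrt s) * nrm (lin S d)"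
      unfolding e_def[abs_def] .
  qed (use s in auto)
qed

lemma Lin_Mult: "f \<in> Lin \<Longrightarrow> f \<in> Mult H"
  by (auto simp: Lin_def lin_def intro!: Mult_sum Mult_scale K_Mult)

text \<open>The kernel \<open>k - 1 = b * k\<close> is positive, so the constant kernel 1 is
  dominated by \<open>k\<close>.\<close>

lemma one_mem: "1 \<in> H"
proof -
  have "1 \<in> H \<and> nrm 1 \<le> 1"
  proof (rule mem_if_bounded_on_lin)
    fix S :: "'x set" and d :: "'x \<Rightarrow> complex" assume S: "finite S"
    have "0 \<le> Re (\<Sum>x\<in>S. \<Sum>y\<in>S. cnj (d x) * d y * (b x y * k x y))"
      by (intro psdD psd_b_mult psd_k S)
    then have "(cmod (\<Sum>x\<in>S. d x))\<^sup>2 \<le> (nrm (lin S d))\<^sup>2"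
      unfolding bk_quadratic nrm_lin_sq by (simp del: Re_sum)
    then have "cmod (\<Sum>x\<in>S. d x) \<le> nrm (lin S d)" by (rule power2_le_imp_le) simp
    moreover have "cmod (\<Sum>z\<in>S. cnj (d z) * 1 z) = cmod (\<Sum>x\<in>S. d x)"
      by (simp flip: cnj_sum)
    ultimately show "cmod (\<Sum>z\<in>S. cnj (d z) * 1 z) \<le> 1 * nrm (lin S d)" by simp
  qed simp
  then show ?thesis by simp
qed

text \<open>This is \<open>R\<^sup>* R \<le> 1\<close> for the row operator \<open>R a = (\<Sum>i. u\<^sub>i a\<^sub>i)\<close>, applied to the vectors \<open>cnj (u y) \<otimes> A y\<close>.\<close>

lemma psd_row_contraction:
  assumes A: "\<And>y. A y \<in> H" and B: "\<And>y. B y \<in> H" and AB: "\<And>x y. B y x = b x y * A y x"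
  shows "psd (\<lambda>x y. b x y * ip (A y) (A x) - ip (B y) (B x))"
  unfolding psd_def
proof (intro allI impI)
  fix S :: "'x set" and c :: "'x \<Rightarrow> complex" assume S: "finite S"
  define F where "F = (\<Sum>y\<in>S. cscale (c y) (B y))"
  define Q where "Q = Re (\<Sum>x\<in>S. \<Sum>y\<in>S. cnj (c x) * c y * (b x y * ip (A y) (A x)))"
  have F: "F \<in> H" unfolding F_def by (intro sum_mem scale_mem B)
  \<comment> \<open>The supremum of the left side over all vectors in place of
    \<open>lin T d\<close> is the squared norm of \<open>F\<close>, attained at \<open>F\<close>. So
    it suffices to test with kernel combinations and then let them approach
    \<open>F\<close>.\<close>
  have key: "2 * Re (ip F (lin T d)) - (nrm (lin T d))\<^sup>2 \<le> Q" if T: "finite T" for T d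
  proof -
    \<comment> \<open>The disjoint sum puts the vectors \<open>A x\<close> and the test kernels
      \<open>K z\<close> into one Gram kernel, weighted by the \<open>u\<close> of the underlying
      points. The minus sign in \<open>c'\<close> makes the cross terms subtract.\<close>
    define \<alpha> where "\<alpha> = case_sum A K"
    define c' where "c' = case_sum c (\<lambda>z. - d z)"
    define v where "v = case_sum u u"
    have \<alpha>: "\<alpha> i \<in> H" for i by (cases i) (auto simp: \<alpha>_def A)
    have v: "v i \<in> ell2" for i by (cases i) (auto simp: v_def u_ell2)
    define C where "C = (\<Sum>x\<in>T. \<Sum>y\<in>S. cnj (d x) * c y * (b x y * A y x))"
    have C: "C = ip F (lin T d)"
    proof -
      have "F x = (\<Sum>y\<in>S. c y * (b x y * A y x))" for x by (simp add: F_def AB)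
      then show ?thesis using F by (simp add: C_def ip_lin_right sum_distrib_left mult.assoc)
    qed
    have C': "(\<Sum>x\<in>S. \<Sum>y\<in>T. cnj (c x) * d y * (b x y * ip (K y) (A x))) = cnj C"
      unfolding C_def by (subst sum.swap) (simp add: ip_K_left[OF A] algebra_simps flip: b_cnj)
    have "0 \<le> Re (\<Sum>x\<in>S <+> T. \<Sum>y\<in>S <+> T.
        cnj (c' x) * c' y * (ell2_inner (v x) (v y) * ip (\<alpha> y) (\<alpha> x)))"
      using S T by (intro psdD psd_ell2_mult psd_gram v \<alpha>) auto
    also have "(\<Sum>x\<in>S <+> T. \<Sum>y\<in>S <+> T.
        cnj (c' x) * c' y * (ell2_inner (v x) (v y) * ip (\<alpha> y) (\<alpha> x))) =
        (\<Sum>x\<in>S. \<Sum>y\<in>S. cnj (c x) * c y * (b x y * ip (A y) (A x))) - cnj C - C +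
        (\<Sum>x\<in>T. \<Sum>y\<in>T. cnj (d x) * d y * (b x y * k x y))"
      unfolding C'[symmetric] unfolding C_def using S T
      by (simp add: sum.Plus c'_def v_def \<alpha>_def b_def[symmetric] ip_K[OF A] ip_K[OF K_mem]
          sum.distrib sum_negf sum_subtractf)
    also have "Re \<dots> = Q - 2 * Re C + ((nrm (lin T d))\<^sup>2 - (cmod (\<Sum>x\<in>T. d x))\<^sup>2)"
      unfolding bk_quadratic Q_def nrm_lin_sq by (simp del: Re_sum)
    \<comment> \<open>The only inequality of the estimate beyond positivity: the squared modulus
      from \<open>bk_quadratic\<close> is dropped.\<close>
    also have "\<dots> \<le> Q - 2 * Re C + (nrm (lin T d))\<^sup>2" by simp
    finally show ?thesis by (simp add: C)
  qed
  obtain G where G: "\<And>n. G n \<in> Lin" "(\<lambda>n. nrm (G n - F)) \<longlonglongrightarrow> 0"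
    using lin_approx_seq[OF F] by blast
  have GH: "G n \<in> H" for n using G Lin_subset by auto
  have le: "2 * Re (ip F (G n)) - (nrm (G n))\<^sup>2 \<le> Q" for n
    using G(1)[of n] key by (auto simp: Lin_def)
  have "(\<lambda>n. ip F (G n)) \<longlonglongrightarrow> ip F F"
    using ip_tendsto[of "\<lambda>_. F" F G F] F GH G(2) by simp
  then have l: "(\<lambda>n. 2 * Re (ip F (G n)) - (nrm (G n))\<^sup>2) \<longlonglongrightarrow> 2 * Re (ip F F) - (nrm F)\<^sup>2"
    by (intro tendsto_intros nrm_tendsto GH F G(2))
  have "2 * Re (ip F F) - (nrm F)\<^sup>2 \<le> Q"
    by (rule Lim_bounded[OF l]) (use le in auto)
  then have "(nrm F)\<^sup>2 \<le> Q" using Re_ip_self[OF F] by simp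
  moreover have "(\<Sum>x\<in>S. \<Sum>y\<in>S. cnj (c x) * c y * (b x y * ip (A y) (A x) - ip (B y) (B x))) =
      (\<Sum>x\<in>S. \<Sum>y\<in>S. cnj (c x) * c y * (b x y * ip (A y) (A x))) - ip F F"
    unfolding F_def gram_sum[OF B, symmetric] by (simp add: right_diff_distrib sum_subtractf)
  ultimately show "0 \<le> Re (\<Sum>x\<in>S. \<Sum>y\<in>S. cnj (c x) * c y * (b x y * ip (A y) (A x) - ip (B y) (B x)))"
    using Re_ip_self[OF F] by (simp add: Q_def del: Re_sum)
qed

text \<open>
  In the classical case of the Hardy space, \<open>2 * herg f - \<parallel>f\<parallel>\<^sup>2\<close> is the Herglotz transform of
  \<open>|f|\<^sup>2\<close>.
\<close>

definition herg :: "('x \<Rightarrow> complex) \<Rightarrow> 'x \<Rightarrow> complex"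
  where "herg f x = ip f (K x * f)"

text \<open>For \<open>f = lin S a\<close> the transform is the kernel combination with coefficients
  \<open>a z * cnj (f z)\<close>. It is therefore a multiplier, which is the reason for starting
  with the kernel span.\<close>

lemma herg_Lin:
  assumes "f \<in> Lin"
  shows "herg f \<in> Lin"
proof -
  obtain S a where f: "f = lin S a" "finite S" using assms by (auto simp: Lin_def)
  have "f \<in> H" using f by simp
  then have "herg f x = lin S (\<lambda>z. a z * cnj (f z)) x" for x
  proof -
    have "herg f x = (\<Sum>z\<in>S. a z * cnj ((K x * f) z))"
      unfolding herg_def f(1)
      by (rule ip_lin_left) (use f \<open>f \<in> H\<close> K_Mult[of x] in \<open>auto intro: Mult_mem\<close>)
    then show ?thesis by (simp add: lin_apply algebra_simps flip: k_cnj)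
  qed
  then have "herg f = lin S (\<lambda>z. a z * cnj (f z))" by (rule ext)
  then show ?thesis unfolding Lin_def using f(2) by blast
qed

text \<open>The row contraction is applied to \<open>A y = K y * f\<close> and
  \<open>B y = A y - f\<close>, then multiplied by \<open>k\<close>. Since
  \<open>k * b = k - 1\<close>, the multiples of \<open>k\<close> by \<open>ip (A y) (A x)\<close>
  cancel; expanding \<open>ip (B y) (B x)\<close> leaves the two \<open>herg\<close> terms and
  \<open>- (nrm f)\<^sup>2 * k\<close>, which is compensated by adding a positive kernel.\<close>

lemma psd_herg:
  assumes f: "f \<in> H"
  shows "psd (\<lambda>x y. (herg f x + cnj (herg f y)) * k x y - ip (K y * f) (K x * f))"
proof -
  define A where "A y = K y * f" for y
  define B where "B y = A y - f" for y
  have A: "A y \<in> H" for y unfolding A_def by (rule Mult_mem[OF K_Mult f])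
  have B: "B y \<in> H" for y unfolding B_def using A f by simp
  have AB: "B y x = b x y * A y x" for x y
  proof -
    have "B y x = (k x y - 1) * f x" by (simp add: B_def A_def algebra_simps)
    also have "k x y - 1 = b x y * k x y" by (metis k_rec add_diff_cancel_left')
    finally show ?thesis by (simp add: A_def)
  qed
  have "psd (\<lambda>x y. k x y * (b x y * ip (A y) (A x) - ip (B y) (B x)))"
    by (intro psd_k_mult psd_row_contraction A B AB)
  moreover have "psd (\<lambda>x y. of_real ((nrm f)\<^sup>2) * k x y)"
    by (intro psd_cmult psd_k) simp
  moreover have "k x y * (b x y * ip (A y) (A x) - ip (B y) (B x)) + of_real ((nrm f)\<^sup>2) * k x y =
      (herg f x + cnj (herg f y)) * k x y - ip (A y) (A x)" for x y
  proof -
    have "ip (B y) (B x) = ip (A y) (A x) - cnj (herg f y) - herg f x + of_real ((nrm f)\<^sup>2)"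
      unfolding B_def herg_def A_def[symmetric]
      using A f ip_cnj[OF f A[of y]] by (simp add: ip_diff ip_diff_right ip_self del: of_real_power)
    moreover have kz: "k x y * (b x y * z) = k x y * z - z" for z
    proof -
      have "b x y * k x y = k x y - 1" by (metis k_rec add_diff_cancel_left')
      then have "(b x y * k x y) * z = (k x y - 1) * z" by (rule arg_cong)
      then show ?thesis by (simp add: left_diff_distrib mult.assoc mult.left_commute)
    qed
    have "k x y * (b x y * P - Q) + N * k x y = (h + h') * k x y - P"
      if "Q = P - h' - h + N" for P Q N h h'
      unfolding right_diff_distrib kz that by (simp add: algebra_simps)
    ultimately show ?thesis by blast
  qed
  ultimately show ?thesis unfolding A_def[symmetric] using psd_add by fastforce
qed

text \<open>On kernel combinations this is the quadratic form of \<open>psd_herg\<close>. Both sides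
  are continuous in \<open>g\<close>, as \<open>f\<close> and \<open>herg f\<close> are bounded
  multipliers, so density finishes the proof.\<close>

lemma herg_accretive:
  assumes f: "f \<in> Lin" and g: "g \<in> H"
  shows "(nrm (f * g))\<^sup>2 \<le> 2 * Re (ip (herg f * g) g)"
proof -
  have fM: "f \<in> Mult H" and hM: "herg f \<in> Mult H" using f herg_Lin Lin_Mult by auto
  have fH: "f \<in> H" using f Lin_subset by auto
  have fin: "(nrm (f * lin S c))\<^sup>2 \<le> 2 * Re (ip (herg f * lin S c) (lin S c))" if S: "finite S" for S c
  proof -
    define D where "D = (\<Sum>x\<in>S. \<Sum>y\<in>S. cnj (c x) * c y * (herg f x * k x y))"
    have D: "ip (herg f * lin S c) (lin S c) = D"
      using Mult_mem[OF hM lin_mem]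
      by (simp add: ip_lin_right lin_apply D_def sum_distrib_left algebra_simps)
    have D': "(\<Sum>x\<in>S. \<Sum>y\<in>S. cnj (c x) * c y * (cnj (herg f y) * k x y)) = cnj D"
      unfolding D_def by (subst sum.swap) (simp add: algebra_simps flip: k_cnj)
    have fl: "f * lin S c = (\<Sum>y\<in>S. cscale (c y) (K y * f))"
      by (auto simp: fun_eq_iff lin_apply sum_distrib_left algebra_simps)
    have "0 \<le> Re (\<Sum>x\<in>S. \<Sum>y\<in>S. cnj (c x) * c y *
        ((herg f x + cnj (herg f y)) * k x y - ip (K y * f) (K x * f)))"
      by (intro psdD psd_herg fH S)
    also have "(\<Sum>x\<in>S. \<Sum>y\<in>S. cnj (c x) * c y *
        ((herg f x + cnj (herg f y)) * k x y - ip (K y * f) (K x * f))) =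
        D + cnj D - (\<Sum>x\<in>S. \<Sum>y\<in>S. cnj (c x) * c y * ip (K y * f) (K x * f))"
      unfolding D'[symmetric] unfolding D_def
      by (simp only: right_diff_distrib distrib_right distrib_left sum_subtractf sum.distrib)
    also have "(\<Sum>x\<in>S. \<Sum>y\<in>S. cnj (c x) * c y * ip (K y * f) (K x * f)) =
        ip (f * lin S c) (f * lin S c)"
      unfolding fl by (rule gram_sum) (rule Mult_mem[OF K_Mult fH])
    finally show ?thesis
      unfolding D Re_ip_self[OF Mult_mem[OF fM lin_mem], symmetric] by simp
  qed
  obtain G where G: "\<And>n. G n \<in> Lin" "(\<lambda>n. nrm (G n - g)) \<longlonglongrightarrow> 0"
    using lin_approx_seq[OF g] by blast
  have GH: "G n \<in> H" for n using G Lin_subset by auto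
  have le: "(nrm (f * G n))\<^sup>2 \<le> 2 * Re (ip (herg f * G n) (G n))" for n
    using G(1)[of n] fin by (auto simp: Lin_def)
  have "(\<lambda>n. (nrm (f * G n))\<^sup>2) \<longlonglongrightarrow> (nrm (f * g))\<^sup>2"
    by (intro tendsto_intros nrm_tendsto Mult_mem[OF fM] Mult_tendsto[OF fM] GH g G(2))
  moreover have "(\<lambda>n. 2 * Re (ip (herg f * G n) (G n))) \<longlonglongrightarrow> 2 * Re (ip (herg f * g) g)"
    by (intro tendsto_intros ip_tendsto Mult_mem[OF hM] Mult_tendsto[OF hM] GH g G(2))
  ultimately show ?thesis by (rule LIMSEQ_le) (use le in auto)
qed

section \<open>Resolvents of accretive multipliers\<close>

definition reg :: "real \<Rightarrow> ('x \<Rightarrow> complex) \<Rightarrow> 'x \<Rightarrow> complex"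
  where "reg t D x = 1 / (1 + of_real t * D x)"

lemma Re_pos_nz: "0 \<le> Re z \<Longrightarrow> 0 \<le> t \<Longrightarrow> 1 + of_real t * z \<noteq> 0"
proof
  assume *: "0 \<le> Re z" "0 \<le> t" "1 + of_real t * z = 0"
  then have "Re (1 + of_real t * z) = 0" by simp
  moreover have "Re (1 + of_real t * z) = 1 + t * Re z" by simp
  ultimately show False using mult_nonneg_nonneg[OF *(2,1)] by linarith
qed

text \<open>Everything comes from expanding the squared norm of \<open>(1 + t D) v\<close> for a
  suitable \<open>v\<close> and dropping squares. In the last bound, \<open>v\<close> is
  \<open>reg t D * g\<close>, and \<open>(1 + t D) v\<close> is \<open>g\<close> itself.\<close>

lemma reg_accretive:
  assumes DM: "D \<in> Mult H" and acc: "\<forall>g\<in>H. 0 \<le> Re (ip (D * g) g)" and t: "t > 0"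
  shows "0 \<le> Re (D x)"
    and "g \<in> H \<Longrightarrow> reg t D * g \<in> H" and "g \<in> H \<Longrightarrow> nrm (reg t D * g) \<le> nrm g"
    and "g \<in> H \<Longrightarrow> 2 * t * Re (ip (D * (reg t D * g)) (reg t D * g)) \<le> (nrm g)\<^sup>2"
proof -
  have Re_D: "0 \<le> Re (D x)" for x
  proof -
    have "ip (D * K x) (K x) = D x * k x x" using Mult_mem[OF DM K_mem] by (simp add: ip_K)
    also have "k x x = of_real ((nrm (K x))\<^sup>2)" using ip_self[OF K_mem, of x] by (simp add: ip_K)
    finally have "ip (D * K x) (K x) = D x * of_real ((nrm (K x))\<^sup>2)" .
    moreover have "0 < (nrm (K x))\<^sup>2"
    proof -
      have "K x \<noteq> 0" using k_nz(2)[of x x] by (metis zero_fun_apply)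
      then show ?thesis by (simp add: nrm_eq_0_iff)
    qed
    ultimately show ?thesis using bspec[OF acc K_mem, of x] by (simp add: zero_le_mult_iff)
  qed
  then show "0 \<le> Re (D x)" .
  have nz: "1 + of_real t * D x \<noteq> 0" for x using Re_pos_nz[OF Re_D] t by simp
  have inv: "reg t D x * (1 + of_real t * D x) = 1" for x using nz by (simp add: reg_def)
  \<comment> \<open>That \<open>reg t D\<close> is a multiplier is not known yet, so the expansion
    is made on the adjoint side: \<open>lin S d\<close> is \<open>lin S e\<close> plus
    \<open>t\<close> times the adjoint of \<open>D\<close> applied to
    \<open>lin S e\<close>.\<close>
  have contr: "nrm (lin S (\<lambda>z. cnj (reg t D z) * d z)) \<le> 1 * nrm (lin S d)" for S d
  proof -
    define e where "e = (\<lambda>z. cnj (reg t D z) * d z)"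
    define e' where "e' = (\<lambda>z. of_real t * (cnj (D z) * e z))"
    have "d z = e z + e' z" for z
    proof -
      have "cnj (reg t D z) * (1 + of_real t * cnj (D z)) = 1"
        using arg_cong[OF inv[of z], of cnj] by simp
      then have "cnj (reg t D z) * (1 + of_real t * cnj (D z)) * d z = d z" by simp
      then show ?thesis by (simp add: e_def e'_def algebra_simps)
    qed
    then have d: "lin S d = lin S e + lin S e'"
      unfolding lin_plus[symmetric] by (intro arg_cong[where f = "lin S"] ext)
    have "lin S e' = cscale (of_real t) (lin S (\<lambda>z. cnj (D z) * e z))"
      by (simp add: lin_scale e'_def)
    moreover have "ip (lin S e) (lin S (\<lambda>z. cnj (D z) * e z)) = ip (D * lin S e) (lin S e)"
      by (simp add: ip_lin_right Mult_mem[OF DM] algebra_simps)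
    ultimately have "Re (ip (lin S e) (lin S e')) = t * Re (ip (D * lin S e) (lin S e))"
      by (simp add: ip_scale_right)
    then have "0 \<le> Re (ip (lin S e) (lin S e'))" using bspec[OF acc lin_mem] t by simp
    then have "(nrm (lin S e))\<^sup>2 \<le> (nrm (lin S d))\<^sup>2"
      unfolding d by (simp add: nrm_add_sq)
    then have "nrm (lin S e) \<le> nrm (lin S d)" by (rule power2_le_imp_le) simp
    then show ?thesis by (simp add: e_def)
  qed
  note M = Mult_if_bounded_on_lin[of "reg t D" 1, OF contr]
  show rH: "reg t D * g \<in> H" if "g \<in> H" for g using Mult_mem[OF M(1) that] by simp
  show "nrm (reg t D * g) \<le> nrm g" if "g \<in> H" for g using M(2)[OF _ that] by simp
  show "2 * t * Re (ip (D * (reg t D * g)) (reg t D * g)) \<le> (nrm g)\<^sup>2" if g: "g \<in> H" for g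
  proof -
    define h where "h = reg t D * g"
    have h: "h \<in> H" using rH[OF g] by (simp add: h_def)
    have Dh: "D * h \<in> H" using Mult_mem[OF DM h] .
    have "g x = (h + cscale (of_real t) (D * h)) x" for x
    proof -
      have "reg t D x * (1 + of_real t * D x) * g x = g x" by (simp add: inv)
      then show ?thesis by (simp add: h_def algebra_simps)
    qed
    then have "g = h + cscale (of_real t) (D * h)" by (rule ext)
    then have "(nrm g)\<^sup>2 = (nrm h)\<^sup>2 + 2 * Re (ip h (cscale (of_real t) (D * h))) +
        (nrm (cscale (of_real t) (D * h)))\<^sup>2"
      using nrm_add_sq[OF h scale_mem[OF Dh]] by simp
    moreover have "Re (ip h (cscale (of_real t) (D * h))) = t * Re (ip (D * h) h)"
      using ip_cnj[OF Dh h] by (simp add: ip_scale_right[OF Dh h])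
    ultimately have "2 * t * Re (ip (D * h) h) \<le> (nrm g)\<^sup>2" by simp
    then show ?thesis by (simp add: h_def)
  qed
qed

lemma herg_tendsto:
  assumes "\<And>n. F n \<in> H" "f \<in> H" "(\<lambda>n. nrm (F n - f)) \<longlonglongrightarrow> 0"
  shows "(\<lambda>n. herg (F n) x) \<longlonglongrightarrow> herg f x"
  unfolding herg_def
  by (intro ip_tendsto Mult_mem[OF K_Mult] Mult_tendsto[OF K_Mult] assms)

text \<open>For general \<open>f1\<close> and \<open>f2\<close> the functions
  \<open>herg f1\<close>, \<open>herg f2\<close> may fail to be multipliers. The estimates are
  proved for kernel combinations, uniformly in \<open>n\<close>, and pass to the pointwise limit;
  \<open>herg\<close> converges pointwise because each \<open>K x\<close> is a multiplier.\<close>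

lemma reg_herg:
  fixes f1 f2 :: "'x \<Rightarrow> complex" and t :: real
  defines "\<phi> \<equiv> reg t (herg f1 + herg f2)"
  assumes f: "f1 \<in> H" "f2 \<in> H" and t: "t > 0"
  shows "0 \<le> Re (herg f1 x + herg f2 x)"
    and "g \<in> H \<Longrightarrow> \<phi> * g \<in> H" and "g \<in> H \<Longrightarrow> nrm (\<phi> * g) \<le> nrm g"
    and "\<phi> * f1 \<in> Mult H" and "\<phi> * f2 \<in> Mult H"
proof -
  obtain F1 where F1: "\<And>n. F1 n \<in> Lin" "(\<lambda>n. nrm (F1 n - f1)) \<longlonglongrightarrow> 0"
    using lin_approx_seq[OF f(1)] by blast
  obtain F2 where F2: "\<And>n. F2 n \<in> Lin" "(\<lambda>n. nrm (F2 n - f2)) \<longlonglongrightarrow> 0"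
    using lin_approx_seq[OF f(2)] by blast
  have FH: "F1 n \<in> H" "F2 n \<in> H" for n using F1 F2 Lin_subset by auto
  define D where "D n = herg (F1 n) + herg (F2 n)" for n
  have DM: "D n \<in> Mult H" for n unfolding D_def by (intro Mult_add Lin_Mult herg_Lin F1 F2)
  have ge: "(nrm (F1 n * g))\<^sup>2 + (nrm (F2 n * g))\<^sup>2 \<le> 2 * Re (ip (D n * g) g)" if g: "g \<in> H" for g n
  proof -
    have "ip (D n * g) g = ip (herg (F1 n) * g) g + ip (herg (F2 n) * g) g"
      unfolding D_def distrib_right by (intro ip_add Mult_mem[OF Lin_Mult] herg_Lin F1 F2 g)
    then show ?thesis
      using herg_accretive[OF F1(1) g, of n] herg_accretive[OF F2(1) g, of n] by simp
  qed
  have acc: "\<forall>g\<in>H. 0 \<le> Re (ip (D n * g) g)" for n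
  proof
    fix g assume g: "g \<in> H"
    have "0 \<le> (nrm (F1 n * g))\<^sup>2 + (nrm (F2 n * g))\<^sup>2" by simp
    then show "0 \<le> Re (ip (D n * g) g)" using ge[OF g, of n] by linarith
  qed
  note R = reg_accretive[OF DM acc t]
  have Dlim: "(\<lambda>n. D n x) \<longlonglongrightarrow> herg f1 x + herg f2 x" for x
    unfolding D_def plus_fun_apply
    by (intro tendsto_intros herg_tendsto FH f F1 F2)
  show Re_D: "0 \<le> Re (herg f1 x + herg f2 x)" for x
    by (rule Lim_bounded2[OF tendsto_Re[OF Dlim]]) (use R(1) in auto)
  have nz: "1 + of_real t * (herg f1 x + herg f2 x) \<noteq> 0" for x
    using Re_pos_nz[OF Re_D] t by simp
  have rlim: "(\<lambda>n. reg t (D n) x) \<longlonglongrightarrow> \<phi> x" for x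
    unfolding \<phi>_def reg_def plus_fun_apply by (intro tendsto_intros Dlim nz)
  have lim1: "(\<lambda>n. (reg t (D n) * g) x) \<longlonglongrightarrow> (\<phi> * g) x" for g x
    unfolding times_fun_apply by (intro tendsto_intros rlim)
  show "\<phi> * g \<in> H" if "g \<in> H" for g
    by (rule pointwise_limit_mem(1)[where G = "\<lambda>n. reg t (D n) * g", OF R(2)[OF that] R(3)[OF that] lim1])
  show "nrm (\<phi> * g) \<le> nrm g" if "g \<in> H" for g
    by (rule pointwise_limit_mem(2)[where G = "\<lambda>n. reg t (D n) * g", OF R(2)[OF that] R(3)[OF that] lim1])
  \<comment> \<open>Accretivity at \<open>reg t (D n) * g\<close> is combined with the last
    resolvent bound. The factor \<open>1 / t\<close> does not depend on \<open>n\<close>, so the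
    estimate survives the limit.\<close>
  have bd: "(nrm (F1 n * (reg t (D n) * g)))\<^sup>2 + (nrm (F2 n * (reg t (D n) * g)))\<^sup>2 \<le> (nrm g)\<^sup>2 / t"
    if g: "g \<in> H" for g n
  proof -
    have "t * ((nrm (F1 n * (reg t (D n) * g)))\<^sup>2 + (nrm (F2 n * (reg t (D n) * g)))\<^sup>2) \<le> 
        t * (2 * Re (ip (D n * (reg t (D n) * g)) (reg t (D n) * g)))"
      using ge[OF R(2)[OF g, of n], of n] t by (intro mult_left_mono) auto
    also have "\<dots> \<le> (nrm g)\<^sup>2" using R(4)[OF g, of n] by (simp add: algebra_simps)
    finally show ?thesis using t by (simp add: field_simps)
  qed
  have mult: "\<phi> * f \<in> Mult H"
    if F: "\<And>n. F n \<in> Lin" "(\<lambda>n. nrm (F n - f)) \<longlonglongrightarrow> 0" "f \<in> H"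
      and bd: "\<And>g n. g \<in> H \<Longrightarrow> (nrm (F n * (reg t (D n) * g)))\<^sup>2 \<le> (nrm g)\<^sup>2 / t" for f F
  proof -
    have "\<phi> * f * g \<in> H" if g: "g \<in> H" for g
    proof (rule pointwise_limit_mem(1)[where G = "\<lambda>n. F n * (reg t (D n) * g)"])
      show "F n * (reg t (D n) * g) \<in> H" for n by (intro Mult_mem[OF Lin_Mult] F R(2) g)
      show "nrm (F n * (reg t (D n) * g)) \<le> sqrt ((nrm g)\<^sup>2 / t)" for n
        by (rule real_le_rsqrt[OF bd[OF g]])
      have FH: "F n \<in> H" for n using F(1) Lin_subset by auto
      have "(\<lambda>n. F n x * (reg t (D n) * g) x) \<longlonglongrightarrow> f x * (\<phi> * g) x" for x
        by (intro tendsto_mult lim1 pointwise_tendsto[OF FH F(3,2)])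
      then show "(\<lambda>n. (F n * (reg t (D n) * g)) x) \<longlonglongrightarrow> (\<phi> * f * g) x" for x
        by (simp add: algebra_simps)
    qed
    then show ?thesis by (simp add: Mult_def)
  qed
  show "\<phi> * f1 \<in> Mult H"
  proof (rule mult[OF F1 f(1)])
    show "(nrm (F1 n * (reg t (D n) * g)))\<^sup>2 \<le> (nrm g)\<^sup>2 / t" if "g \<in> H" for g n
      using bd[OF that, of n] zero_le_power2[of "nrm (F2 n * (reg t (D n) * g))"] by linarith
  qed
  show "\<phi> * f2 \<in> Mult H"
  proof (rule mult[OF F2 f(2)])
    show "(nrm (F2 n * (reg t (D n) * g)))\<^sup>2 \<le> (nrm g)\<^sup>2 / t" if "g \<in> H" for g n
      using bd[OF that, of n] zero_le_power2[of "nrm (F1 n * (reg t (D n) * g))"] by linarith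
  qed
qed

text \<open>Two functions at once, because the lemma serves the pairs \<open>f\<close>,
  \<open>h * f\<close> and \<open>g\<close>, \<open>Ts g\<close>, whose members must be tamed by the
  same multiplier. Contractions that converge pointwise to 1 converge weakly, and weak convergence
  is all that the annihilator argument asks for.\<close>

lemma multiplier_approximation:
  assumes f: "f1 \<in> H" "f2 \<in> H"
  shows "\<exists>\<phi>. (\<forall>n. \<phi> n \<in> Mult H \<and> \<phi> n * f1 \<in> Mult H \<and> \<phi> n * f2 \<in> Mult H) \<and>
    (\<forall>g\<in>H. \<forall>w\<in>H. (\<lambda>n. ip (\<phi> n * g) w) \<longlonglongrightarrow> ip g w)"
proof -
  define t where "t n = inverse (real (Suc n))" for n
  have t: "t n > 0" for n by (simp add: t_def)
  define \<phi> where "\<phi> n = reg (t n) (herg f1 + herg f2)" for n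
  note R = reg_herg[OF f t, folded \<phi>_def]
  have t0: "t \<longlonglongrightarrow> 0" unfolding t_def[abs_def] by (rule LIMSEQ_inverse_real_of_nat)
  have "(\<lambda>n. ip (\<phi> n * g) w) \<longlonglongrightarrow> ip g w" if g: "g \<in> H" and w: "w \<in> H" for g w
  proof (rule weak_tendsto[OF R(2)[OF g] R(3)[OF g] g _ w])
    fix x
    have "(\<lambda>n. 1 / (1 + of_real (t n) * (herg f1 x + herg f2 x)) * g x) \<longlonglongrightarrow>
        1 / (1 + of_real 0 * (herg f1 x + herg f2 x)) * g x"
      by (intro tendsto_intros t0) simp
    then show "(\<lambda>n. (\<phi> n * g) x) \<longlonglongrightarrow> g x" by (simp add: \<phi>_def reg_def)
  qed
  moreover have "\<phi> n \<in> Mult H" for n using R(2) by (simp add: Mult_def)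
  ultimately show ?thesis using R(4,5) by blast
qed

end

section \<open>Densely defined multipliers\<close>

locale cnp_multiplier = cnp H ip k u
  for H :: "('x \<Rightarrow> complex) set" and ip :: "'x cinner" and k and u :: "'x \<Rightarrow> 'i \<Rightarrow> complex" +
  fixes h :: "'x \<Rightarrow> complex"
  assumes dense: "densely_defined_multiplier H ip h"
begin

abbreviation Dom :: "('x \<Rightarrow> complex) set"
  where "Dom \<equiv> mult_dom H h"

abbreviation V :: "('x \<Rightarrow> complex) set"
  where "V \<equiv> HB H ip h"

abbreviation Ts :: "('x \<Rightarrow> complex) \<Rightarrow> 'x \<Rightarrow> complex"
  where "Ts \<equiv> Tstar H ip h"

section \<open>The adjoint operator and its graph norm\<close>

lemma Dom_iff: "f \<in> Dom \<longleftrightarrow> f \<in> H \<and> h * f \<in> H"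
  by (simp add: mult_dom_def)

lemma Dom_mem: "f \<in> Dom \<Longrightarrow> f \<in> H" "f \<in> Dom \<Longrightarrow> h * f \<in> H"
  by (auto simp: Dom_iff)

lemma Dom_subset: "Dom \<subseteq> H" and Dom_dense: "norm_topology H nrm closure_of Dom = H"
  using dense by (auto simp: densely_defined_multiplier_def norm_dense_def)

lemma Dom_Mult: "\<phi> \<in> Mult H \<Longrightarrow> f \<in> Dom \<Longrightarrow> \<phi> * f \<in> Dom"
  unfolding Dom_iff by (metis Mult_mem mult.left_commute)

lemma Ts_unique:
  assumes "w \<in> H" "w' \<in> H" "\<forall>f\<in>Dom. ip (h * f) g = ip f w" "\<forall>f\<in>Dom. ip (h * f) g = ip f w'"
  shows "w = w'"
  by (rule ip_right_unique[OF Dom_subset Dom_dense]) (use assms in auto)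

text \<open>Density of \<open>Dom\<close> makes the description in \<open>adj\<close> unique. Later
  values of \<open>Ts\<close> are found by guessing them and checking the defining identity.\<close>

lemma Ts_eqI:
  assumes "g \<in> H" "w \<in> H" "\<And>f. f \<in> Dom \<Longrightarrow> ip (h * f) g = ip f w"
  shows "g \<in> V" and "Ts g = w"
proof -
  show "g \<in> V" using assms by (auto simp: HB_def adj_dom_def)
  show "Ts g = w"
    unfolding Tstar_def adj_def
    by (rule the_equality) (use assms Ts_unique in blast)+
qed

lemma V_mem: "g \<in> V \<Longrightarrow> g \<in> H"
  by (simp add: HB_def adj_dom_def)

lemma Ts:
  assumes "g \<in> V"
  shows "Ts g \<in> H" and "f \<in> Dom \<Longrightarrow> ip (h * f) g = ip f (Ts g)"
proof -
  obtain w where w: "w \<in> H" "\<And>f. f \<in> Dom \<Longrightarrow> ip (h * f) g = ip f w"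
    using assms by (auto simp: HB_def adj_dom_def)
  have "Ts g = w" using Ts_eqI(2)[OF V_mem[OF assms] w] by blast
  then show "Ts g \<in> H" "f \<in> Dom \<Longrightarrow> ip (h * f) g = ip f (Ts g)" using w by auto
qed

lemma Ts_add:
  assumes "f \<in> V" "g \<in> V"
  shows "f + g \<in> V" and "Ts (f + g) = Ts f + Ts g"
proof -
  have *: "f + g \<in> H" "Ts f + Ts g \<in> H"
    "\<And>a. a \<in> Dom \<Longrightarrow> ip (h * a) (f + g) = ip a (Ts f + Ts g)"
    using assms by (auto simp: ip_add_right V_mem Ts Dom_mem)
  show "f + g \<in> V" "Ts (f + g) = Ts f + Ts g" using Ts_eqI[OF *] by blast+
qed

lemma Ts_scale:
  assumes "f \<in> V"
  shows "cscale c f \<in> V" and "Ts (cscale c f) = cscale c (Ts f)"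
proof -
  have *: "cscale c f \<in> H" "cscale c (Ts f) \<in> H"
    "\<And>a. a \<in> Dom \<Longrightarrow> ip (h * a) (cscale c f) = ip a (cscale c (Ts f))"
    using assms by (auto simp: ip_scale_right V_mem Ts Dom_mem)
  show "cscale c f \<in> V" "Ts (cscale c f) = cscale c (Ts f)" using Ts_eqI[OF *] by blast+
qed

lemma V_subspace: "cfun.subspace V"
proof (rule cfun.subspaceI)
  show "0 \<in> V" by (rule Ts_eqI(1)[of 0 0]) (auto simp: Dom_mem)
qed (auto intro: Ts_add Ts_scale)

lemma V_diff: "f \<in> V \<Longrightarrow> g \<in> V \<Longrightarrow> f - g \<in> V"
  by (rule cfun.subspace_diff[OF V_subspace])

lemma Ts_diff: "f \<in> V \<Longrightarrow> g \<in> V \<Longrightarrow> Ts (f - g) = Ts f - Ts g"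
  using Ts_add(2)[OF V_diff, of f g g] by (simp add: algebra_simps)

text \<open>An inner product inducing the graph norm, introduced so that the Hilbert space results,
  above all orthogonal projection, apply to the domain of the adjoint.\<close>

definition ipB :: "'x cinner"
  where "ipB f g = ip f g + ip (Ts f) (Ts g)"

lemma ipB_self: "f \<in> V \<Longrightarrow> Re (ipB f f) = (nrm f)\<^sup>2 + (nrm (Ts f))\<^sup>2"
  by (simp add: ipB_def Re_ip_self V_mem Ts)

lemma HB_norm_eq: "f \<in> V \<Longrightarrow> ip_norm ipB f = HB_norm H ip h f"
  by (simp add: HB_norm_def graph_norm_def ip_norm_def[of ipB] ipB_self)

lemma nrm_le_HB_norm: "f \<in> V \<Longrightarrow> nrm f \<le> ip_norm ipB f" "f \<in> V \<Longrightarrow> nrm (Ts f) \<le> ip_norm ipB f"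
  by (auto simp: ip_norm_def[of ipB] ipB_self intro: real_le_rsqrt)

text \<open>The two norms are compared only on \<open>V\<close>, but \<open>norm_dist\<close>
  vanishes off the carrier, so the distances coincide on the whole type.\<close>

lemma V_norm_topology: "norm_topology V (HB_norm H ip h) = norm_topology V (ip_norm ipB)"
proof -
  have "norm_dist V (HB_norm H ip h) = norm_dist V (ip_norm ipB)"
    by (auto simp: fun_eq_iff norm_dist_def HB_norm_eq V_diff)
  then show ?thesis by (simp add: norm_topology_def)
qed

lemma nrmB_tendsto:
  assumes "\<And>n. F n \<in> V" "f \<in> V" "(\<lambda>n. nrm (F n - f)) \<longlonglongrightarrow> 0" "(\<lambda>n. nrm (Ts (F n) - Ts f)) \<longlonglongrightarrow> 0"
  shows "(\<lambda>n. ip_norm ipB (F n - f)) \<longlonglongrightarrow> 0"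
proof -
  have "ip_norm ipB (F n - f) = sqrt ((nrm (F n - f))\<^sup>2 + (nrm (Ts (F n) - Ts f))\<^sup>2)" for n
    using assms by (simp add: ip_norm_def[of ipB] ipB_self V_diff Ts_diff)
  moreover have "(\<lambda>n. sqrt ((nrm (F n - f))\<^sup>2 + (nrm (Ts (F n) - Ts f))\<^sup>2)) \<longlonglongrightarrow> sqrt (0\<^sup>2 + 0\<^sup>2)"
    by (intro tendsto_intros assms)
  ultimately show ?thesis by simp
qed

lemma nrmB_eq: "f \<in> V \<Longrightarrow> ip_norm ipB f = sqrt ((nrm f)\<^sup>2 + (nrm (Ts f))\<^sup>2)"
  by (simp add: ip_norm_def[of ipB] ipB_self)

text \<open>Completeness is formulated for a metric, so the metric laws have to precede the Hilbert
  space structure of \<open>V\<close>. The triangle inequality combines those for both components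
  with Minkowski's inequality in the plane.\<close>

lemma metric_V: "Metric_space V (norm_dist V (ip_norm ipB))"
proof
  show "0 \<le> norm_dist V (ip_norm ipB) f g" for f g
    by (simp add: norm_dist_def nrmB_eq V_diff)
  show "norm_dist V (ip_norm ipB) f g = norm_dist V (ip_norm ipB) g f" for f g
  proof (cases "f \<in> V \<and> g \<in> V")
    case True
    then show ?thesis
      using nrm_diff_commute[of f g] nrm_diff_commute[of "Ts f" "Ts g"]
      by (simp add: norm_dist_def nrmB_eq V_diff Ts_diff Ts V_mem)
  qed (auto simp: norm_dist_def)
  show "norm_dist V (ip_norm ipB) f g = 0 \<longleftrightarrow> f = g" if fg: "f \<in> V" "g \<in> V" for f g
  proof
    assume "norm_dist V (ip_norm ipB) f g = 0"
    then have "nrm (f - g) \<le> 0"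
      using nrm_le_HB_norm(1)[OF V_diff[OF fg]] fg by (simp add: norm_dist_def)
    moreover have "0 \<le> nrm (f - g)" by (intro nrm_nonneg diff_mem V_mem fg)
    ultimately have "nrm (f - g) = 0" by (rule order_antisym)
    then show "f = g" using nrm_eq_0_iff[of "f - g"] fg by (simp add: V_mem)
  next
    have "Ts 0 = 0" using Ts_diff[OF fg(1) fg(1)] by simp
    moreover have "0 \<in> V" using V_diff[OF fg(1) fg(1)] by simp
    moreover assume "f = g"
    ultimately show "norm_dist V (ip_norm ipB) f g = 0" by (simp add: norm_dist_def nrmB_eq)
  qed
  show "norm_dist V (ip_norm ipB) f w \<le> norm_dist V (ip_norm ipB) f g + norm_dist V (ip_norm ipB) g w"
    if V: "f \<in> V" "g \<in> V" "w \<in> V" for f g w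
  proof -
    have "ip_norm ipB (f - w) = sqrt ((nrm (f - w))\<^sup>2 + (nrm (Ts f - Ts w))\<^sup>2)"
      using V by (simp add: nrmB_eq V_diff Ts_diff)
    also have "\<dots> \<le> sqrt ((nrm (f - g) + nrm (g - w))\<^sup>2 + (nrm (Ts f - Ts g) + nrm (Ts g - Ts w))\<^sup>2)"
      using V by (intro real_sqrt_le_mono add_mono power_mono nrm_triangle_diff nrm_nonneg)
        (auto simp: V_mem Ts)
    also have "\<dots> \<le> sqrt ((nrm (f - g))\<^sup>2 + (nrm (Ts f - Ts g))\<^sup>2) +
        sqrt ((nrm (g - w))\<^sup>2 + (nrm (Ts g - Ts w))\<^sup>2)"
      by (rule real_sqrt_sum_squares_triangle_ineq)
    also have "\<dots> = ip_norm ipB (f - g) + ip_norm ipB (g - w)"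
      using V by (simp add: nrmB_eq V_diff Ts_diff)
    finally show ?thesis using V by (simp add: norm_dist_def)
  qed
qed

text \<open>An adjoint is a closed operator: limits of \<open>F n\<close> and of
  \<open>Ts (F n)\<close> satisfy the defining identity together.\<close>

lemma V_complete: "Metric_space.mcomplete V (norm_dist V (ip_norm ipB))"
  unfolding Metric_space.mcomplete_def[OF metric_V]
proof (intro allI impI)
  fix F assume "Metric_space.MCauchy V (norm_dist V (ip_norm ipB)) F"
  then have F: "range F \<subseteq> V"
    and c: "\<And>\<epsilon>. \<epsilon> > 0 \<Longrightarrow> \<exists>N. \<forall>m n. N \<le> m \<longrightarrow> N \<le> n \<longrightarrow> norm_dist V (ip_norm ipB) (F m) (F n) < \<epsilon>"
    unfolding Metric_space.MCauchy_def[OF metric_V] by auto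
  have FV: "F n \<in> V" for n using F by auto
  have c': "\<exists>N. \<forall>m\<ge>N. \<forall>n\<ge>N. nrm (F m - F n) < \<epsilon> \<and> nrm (Ts (F m) - Ts (F n)) < \<epsilon>"
    if e: "\<epsilon> > 0" for \<epsilon>
  proof -
    obtain N where N: "\<And>m n. N \<le> m \<Longrightarrow> N \<le> n \<Longrightarrow> ip_norm ipB (F m - F n) < \<epsilon>"
      using c[OF e] FV by (auto simp: norm_dist_def)
    have "nrm (F m - F n) < \<epsilon> \<and> nrm (Ts (F m) - Ts (F n)) < \<epsilon>" if "N \<le> m" "N \<le> n" for m n
      using N[OF that] nrm_le_HB_norm[OF V_diff[OF FV FV], of m n] Ts_diff[OF FV FV, of m n] by simp
    then show ?thesis by blast
  qed
  obtain f where f: "f \<in> H" "(\<lambda>n. nrm (F n - f)) \<longlonglongrightarrow> 0"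
    using cauchy_convergent[of F] c' FV V_mem by meson
  obtain w where w: "w \<in> H" "(\<lambda>n. nrm (Ts (F n) - w)) \<longlonglongrightarrow> 0"
    using cauchy_convergent[of "\<lambda>n. Ts (F n)"] c' FV Ts(1) by meson
  have eq: "ip (h * a) f = ip a w" if a: "a \<in> Dom" for a
  proof (rule LIMSEQ_unique)
    show "(\<lambda>n. ip (h * a) (F n)) \<longlonglongrightarrow> ip (h * a) f"
      by (rule ip_tendsto[of "\<lambda>_. h * a"]) (use f a Dom_mem FV V_mem in auto)
    have "(\<lambda>n. ip a (Ts (F n))) \<longlonglongrightarrow> ip a w"
      by (rule ip_tendsto[of "\<lambda>_. a"]) (use w a Dom_mem FV Ts(1) in auto)
    then show "(\<lambda>n. ip (h * a) (F n)) \<longlonglongrightarrow> ip a w" using Ts(2)[OF FV a] by simp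
  qed
  have fV: "f \<in> V" and Tf: "Ts f = w" using Ts_eqI[OF f(1) w(1) eq] by blast+
  have l: "(\<lambda>n. ip_norm ipB (F n - f)) \<longlonglongrightarrow> 0"
    by (rule nrmB_tendsto[OF FV fV f(2)]) (simp add: Tf w)
  have "\<forall>\<^sub>F n in sequentially. F n \<in> V \<and> norm_dist V (ip_norm ipB) (F n) f < \<epsilon>" if "\<epsilon> > 0" for \<epsilon>
    using order_tendstoD(2)[OF l that] by (rule eventually_mono) (simp add: norm_dist_def FV fV)
  then show "\<exists>f. limitin (Metric_space.mtopology V (norm_dist V (ip_norm ipB))) F f sequentially"
    unfolding Metric_space.limitin_metric[OF metric_V] using fV by blast
qed

sublocale B: hilbert_function_space V ipB
proof
  show "cfun.subspace V" by (rule V_subspace)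
  show "Metric_space.mcomplete V (norm_dist V (ip_norm ipB))" by (rule V_complete)
  fix f g w c
  show "ipB (f + g) w = ipB f w + ipB g w" if "f \<in> V" "g \<in> V" "w \<in> V"
    using that by (simp add: ipB_def Ts_add(2) ip_add V_mem Ts(1))
  show "ipB (cscale c f) w = c * ipB f w" if "f \<in> V" "w \<in> V"
    using that by (simp add: ipB_def Ts_scale(2) ip_scale V_mem Ts(1) distrib_left)
  show "ipB g f = cnj (ipB f g)" if "f \<in> V" "g \<in> V"
    using that ip_cnj[of f g] ip_cnj[of "Ts f" "Ts g"] by (simp add: ipB_def V_mem Ts(1))
  show "0 < Re (ipB f f)" if "f \<in> V" "f \<noteq> 0"
    using that ip_pos[of f] Re_ip_nonneg[of "Ts f"] by (simp add: ipB_def V_mem Ts(1))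
qed

section \<open>Kernel functions and multiplier adjoints in the domain of the adjoint\<close>

lemma V_subset: "V \<subseteq> H"
  using V_mem by blast

text \<open>Kernel functions are eigenvectors of the adjoint: \<open>K y\<close> is multiplied by
  \<open>cnj (h y)\<close>.\<close>

lemma Lin_subset_V: "Lin \<subseteq> V"
proof -
  have K: "K y \<in> V" for y
  proof (rule Ts_eqI(1)[of _ "cscale (cnj (h y)) (K y)"])
    show "ip (h * f) (K y) = ip f (cscale (cnj (h y)) (K y))" if "f \<in> Dom" for f
      using that Dom_mem[OF that] by (simp add: ip_K ip_scale_right)
  qed auto
  have "lin S d \<in> V" for S d
    unfolding lin_def
    by (rule cfun.subspace_sum[OF V_subspace]) (rule cfun.subspace_scale[OF V_subspace K])
  then show ?thesis unfolding Lin_def by blast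
qed

lemma V_dense: "norm_topology H nrm closure_of V = H"
  using closure_of_mono[OF Lin_subset_V, of "norm_topology H nrm"] Lin_dense
    closure_of_subset_carrier[OF V_subset] by blast

text \<open>Multiplication by \<open>h\<close> commutes with multiplication by
  \<open>\<phi>\<close>, which preserves \<open>Dom\<close>; the adjoints therefore commute as
  well.\<close>

lemma Mult_adj_V:
  assumes phi: "\<phi> \<in> Mult H" and g: "g \<in> V"
  shows "Mult_adj H ip \<phi> g \<in> V" and "Ts (Mult_adj H ip \<phi> g) = Mult_adj H ip \<phi> (Ts g)"
proof -
  have "ip (h * f) (Mult_adj H ip \<phi> g) = ip f (Mult_adj H ip \<phi> (Ts g))" if f: "f \<in> Dom" for f
  proof -
    have "ip (h * f) (Mult_adj H ip \<phi> g) = ip (\<phi> * (h * f)) g"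
      using Mult_adj(2)[OF phi V_mem[OF g] Dom_mem(2)[OF f]] by simp
    also have "\<phi> * (h * f) = h * (\<phi> * f)" by (rule mult.left_commute)
    also have "ip (h * (\<phi> * f)) g = ip (\<phi> * f) (Ts g)" by (rule Ts(2)[OF g Dom_Mult[OF phi f]])
    also have "\<dots> = ip f (Mult_adj H ip \<phi> (Ts g))"
      by (rule Mult_adj(2)[OF phi Ts(1)[OF g] Dom_mem(1)[OF f]])
    finally show ?thesis .
  qed
  note E = Ts_eqI[OF Mult_adj(1)[OF phi V_mem[OF g]] Mult_adj(1)[OF phi Ts(1)[OF g]] this]
  show "Mult_adj H ip \<phi> g \<in> V" by (rule E(1))
  show "Ts (Mult_adj H ip \<phi> g) = Mult_adj H ip \<phi> (Ts g)" by (rule E(2))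
qed

text \<open>Since \<open>Mult_adj H ip \<phi>\<close> commutes with \<open>Ts\<close>, its
  continuity on \<open>H\<close> makes it continuous for the graph norm.\<close>

lemma star_invariant_V_closure:
  assumes J: "J \<subseteq> V" "star_invariant H ip J"
  shows "star_invariant H ip (norm_topology V B.nrm closure_of J)"
  unfolding star_invariant_def
proof (intro ballI subsetI)
  fix \<phi> v assume phi: "\<phi> \<in> Mult H" and "v \<in> Mult_adj H ip \<phi> ` (norm_topology V B.nrm closure_of J)"
  then obtain g where v: "v = Mult_adj H ip \<phi> g" and "g \<in> norm_topology V B.nrm closure_of J" by blast
  then obtain F where g: "g \<in> V" and F: "range F \<subseteq> J" "(\<lambda>n. B.nrm (F n - g)) \<longlonglongrightarrow> 0"
    unfolding B.closure_of_iff_seq[OF J(1)] by blast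
  have FJ: "F n \<in> J" "F n \<in> V" for n using F J by auto
  have l: "(\<lambda>n. nrm (F n - g)) \<longlonglongrightarrow> 0"
    by (rule tendsto_sandwich[OF _ _ tendsto_const F(2)];
        intro always_eventually allI nrm_nonneg diff_mem V_mem nrm_le_HB_norm(1) V_diff FJ g)
  have l': "(\<lambda>n. nrm (Ts (F n) - Ts g)) \<longlonglongrightarrow> 0"
    unfolding Ts_diff[OF FJ(2) g, symmetric]
    by (rule tendsto_sandwich[OF _ _ tendsto_const F(2)];
        intro always_eventually allI nrm_nonneg Ts(1) nrm_le_HB_norm(2) V_diff FJ g)
  have "range (\<lambda>n. Mult_adj H ip \<phi> (F n)) \<subseteq> J"
    using J(2) phi FJ by (auto simp: star_invariant_def)
  moreover have "(\<lambda>n. B.nrm (Mult_adj H ip \<phi> (F n) - v)) \<longlonglongrightarrow> 0"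
    unfolding v
  proof (rule nrmB_tendsto)
    show "(\<lambda>n. nrm (Mult_adj H ip \<phi> (F n) - Mult_adj H ip \<phi> g)) \<longlonglongrightarrow> 0"
      by (intro Mult_adj_tendsto phi V_mem FJ g l)
    show "(\<lambda>n. nrm (Ts (Mult_adj H ip \<phi> (F n)) - Ts (Mult_adj H ip \<phi> g))) \<longlonglongrightarrow> 0"
      unfolding Mult_adj_V(2)[OF phi FJ(2)] Mult_adj_V(2)[OF phi g]
      by (intro Mult_adj_tendsto phi Ts(1) FJ g l')
  qed (intro Mult_adj_V(1) phi FJ g)+
  moreover have "v \<in> V" unfolding v by (intro Mult_adj_V(1) phi g)
  ultimately show "v \<in> norm_topology V B.nrm closure_of J"
    unfolding B.closure_of_iff_seq[OF J(1)] by (intro conjI exI[of _ "\<lambda>n. Mult_adj H ip \<phi> (F n)"])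
qed

lemma V_closure_subset:
  assumes J: "J \<subseteq> V"
  shows "norm_topology V B.nrm closure_of J \<subseteq> norm_topology H nrm closure_of J"
proof
  fix g assume "g \<in> norm_topology V B.nrm closure_of J"
  then have g: "g \<in> V" and a: "\<forall>\<epsilon>>0. \<exists>f\<in>J. B.nrm (g - f) < \<epsilon>"
    unfolding B.closure_of_iff[OF J] by auto
  have "\<exists>f\<in>J. nrm (g - f) < \<epsilon>" if e: "\<epsilon> > 0" for \<epsilon>
  proof -
    obtain f where "f \<in> J" "B.nrm (g - f) < \<epsilon>" using a e by blast
    then show ?thesis using nrm_le_HB_norm(1)[OF V_diff[OF g], of f] J by force
  qed
  then show "g \<in> norm_topology H nrm closure_of J"
    using closure_of_iff[of J] J V_subset V_mem[OF g] by auto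
qed

section \<open>Annihilators of an invariant subspace in the graph\<close>

lemma annihilator_step:
  assumes J: "J \<subseteq> V" "star_invariant H ip J"
    and g: "g \<in> V" "g \<in> norm_topology H nrm closure_of J"
    and n: "n1 \<in> H" "n2 \<in> H" "\<And>j. j \<in> J \<Longrightarrow> ip n1 j + ip n2 (Ts j) = 0"
    and q: "q \<in> Mult H" "h * q \<in> Mult H"
  shows "ip (q * n1) g + ip (q * n2) (Ts g) = 0"
proof -
  have qn: "q * n1 \<in> H" "q * n2 \<in> H" "h * (q * n2) \<in> H"
    using Mult_mem[OF q(1) n(1)] Mult_mem[OF q(1) n(2)] Mult_mem[OF q(2) n(2)]
    unfolding mult.assoc by blast+
  \<comment> \<open>Membership in \<open>Dom\<close> lets the pairing of \<open>q * n2\<close> with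
    \<open>Ts j\<close> be rewritten as a pairing with \<open>j\<close> itself. What remains depends
    on \<open>j\<close> continuously in \<open>H\<close>, and hence carries over to
    \<open>g\<close>.\<close>
  then have qD: "q * n2 \<in> Dom" unfolding Dom_iff by blast
  have "ip (q * n1 + h * (q * n2)) j = 0" if j: "j \<in> J" for j
  proof -
    have jV: "j \<in> V" using J j by auto
    have "Mult_adj H ip q j \<in> J" using J(2) q(1) j by (auto simp: star_invariant_def)
    then have "ip n1 (Mult_adj H ip q j) + ip n2 (Ts (Mult_adj H ip q j)) = 0" by (rule n(3))
    then have "ip (q * n1) j + ip (q * n2) (Ts j) = 0"
      unfolding Mult_adj(2)[OF q(1) V_mem[OF jV] n(1)] Mult_adj(2)[OF q(1) Ts(1)[OF jV] n(2)]
        Mult_adj_V(2)[OF q(1) jV] .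
    then show ?thesis
      unfolding Ts(2)[OF jV qD, symmetric] ip_add[OF qn(1,3) V_mem[OF jV]] .
  qed
  then have "ip (q * n1 + h * (q * n2)) g = 0"
    by (rule ip_zero_closure[OF order_trans[OF J(1) V_subset] add_mem[OF qn(1,3)] _ g(2)])
  then show ?thesis
    unfolding Ts(2)[OF g(1) qD, symmetric] ip_add[OF qn(1,3) V_mem[OF g(1)]] .
qed

text \<open>The step that removes \<open>q\<close>. That \<open>n1\<close> and \<open>n2\<close> are
  multipliers keeps \<open>n1 * f\<close> and \<open>n2 * f\<close> in \<open>H\<close> for
  \<open>f\<close> in \<open>Dom\<close>, and makes them converge in norm when \<open>f\<close>
  tends to 1.\<close>

lemma annihilator_multiplier:
  assumes J: "J \<subseteq> V" "star_invariant H ip J"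
    and g: "g \<in> V" "g \<in> norm_topology H nrm closure_of J"
    and n: "n1 \<in> H" "n2 \<in> H" "\<And>j. j \<in> J \<Longrightarrow> ip n1 j + ip n2 (Ts j) = 0"
    and M: "n1 \<in> Mult H" "n2 \<in> Mult H"
  shows "ip n1 g + ip n2 (Ts g) = 0"
proof -
  have gH: "g \<in> H" "Ts g \<in> H" using V_mem Ts g by auto
  have Dom0: "ip (n1 * f) g + ip (n2 * f) (Ts g) = 0" if f: "f \<in> Dom" for f
  proof -
    obtain \<phi> where \<phi>: "\<And>m. \<phi> m \<in> Mult H" "\<And>m. \<phi> m * f \<in> Mult H" "\<And>m. \<phi> m * (h * f) \<in> Mult H"
      and l: "\<And>v w. v \<in> H \<Longrightarrow> w \<in> H \<Longrightarrow> (\<lambda>m. ip (\<phi> m * v) w) \<longlonglongrightarrow> ip v w"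
      using multiplier_approximation[OF Dom_mem[OF f]] by blast
    have "ip (\<phi> m * (n1 * f)) g + ip (\<phi> m * (n2 * f)) (Ts g) = 0" for m
    proof -
      \<comment> \<open>With \<open>q = \<phi> m * f\<close>, the product \<open>h * q\<close>
        equals \<open>\<phi> m * (h * f)\<close>, a multiplier because the approximation was chosen
        for \<open>f\<close> and \<open>h * f\<close> together.\<close>
      have "h * (\<phi> m * f) \<in> Mult H" using \<phi>(3)[of m] by (simp add: mult.left_commute)
      moreover have "\<phi> m * f * n1 = \<phi> m * (n1 * f)" "\<phi> m * f * n2 = \<phi> m * (n2 * f)"
        by (simp_all add: mult_ac)
      ultimately show ?thesis using annihilator_step[OF J g n \<phi>(2), of m] by (simp only:)
    qed
    moreover have "(\<lambda>m. ip (\<phi> m * (n1 * f)) g + ip (\<phi> m * (n2 * f)) (Ts g)) \<longlonglongrightarrow>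
        ip (n1 * f) g + ip (n2 * f) (Ts g)"
      by (intro tendsto_add l Mult_mem M Dom_mem(1) f gH)
    ultimately show ?thesis by (simp add: LIMSEQ_const_iff)
  qed
  have "1 \<in> norm_topology H nrm closure_of Dom" using one_mem Dom_dense by simp
  then obtain F where F: "range F \<subseteq> Dom" "(\<lambda>m. nrm (F m - 1)) \<longlonglongrightarrow> 0"
    unfolding closure_of_iff_seq[OF Dom_subset] by blast
  have FD: "F m \<in> Dom" for m using F by auto
  have "(\<lambda>m. ip (n1 * F m) g + ip (n2 * F m) (Ts g)) \<longlonglongrightarrow> ip (n1 * 1) g + ip (n2 * 1) (Ts g)"
    by (intro tendsto_add ip_tendsto_left Mult_mem Mult_tendsto M Dom_mem(1) FD gH one_mem F)
  then show ?thesis using Dom0[OF FD] by (simp add: LIMSEQ_const_iff)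
qed

text \<open>Multiplying the annihilating pair \<open>g\<close>, \<open>Ts g\<close> by
  \<open>\<phi> m\<close> makes both entries multipliers, and invariance of \<open>J\<close> keeps
  it annihilating. In the weak limit its pairing with \<open>g\<close>, \<open>Ts g\<close> becomes
  the squared graph norm of \<open>g\<close>.\<close>

lemma orthogonal_in_closure_eq_0:
  assumes J: "J \<subseteq> V" "star_invariant H ip J"
    and g: "g \<in> V" "g \<in> norm_topology H nrm closure_of J"
    and orth: "\<And>j. j \<in> J \<Longrightarrow> ipB j g = 0"
  shows "g = 0"
proof -
  have gH: "g \<in> H" "Ts g \<in> H" using V_mem Ts g by auto
  have orth': "ip g j + ip (Ts g) (Ts j) = 0" if "j \<in> J" for j
  proof -
    have "j \<in> V" using that J by auto
    then have "ipB g j = cnj (ipB j g)" using g(1) by (intro B.ip_cnj)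
    then have "ipB g j = 0" using orth[OF that] by simp
    then show ?thesis by (simp add: ipB_def)
  qed
  obtain \<phi> where \<phi>: "\<And>m. \<phi> m \<in> Mult H" "\<And>m. \<phi> m * g \<in> Mult H" "\<And>m. \<phi> m * Ts g \<in> Mult H"
    and l: "\<And>v w. v \<in> H \<Longrightarrow> w \<in> H \<Longrightarrow> (\<lambda>m. ip (\<phi> m * v) w) \<longlonglongrightarrow> ip v w"
    using multiplier_approximation[OF gH] by blast
  have "ip (\<phi> m * g) g + ip (\<phi> m * Ts g) (Ts g) = 0" for m
  proof (rule annihilator_multiplier[OF J g])
    fix j assume j: "j \<in> J"
    have jV: "j \<in> V" using j J by auto
    have "Mult_adj H ip (\<phi> m) j \<in> J" using J(2) \<phi>(1) j by (auto simp: star_invariant_def)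
    from orth'[OF this] show "ip (\<phi> m * g) j + ip (\<phi> m * Ts g) (Ts j) = 0"
      unfolding Mult_adj(2)[OF \<phi>(1) V_mem[OF jV] gH(1)] Mult_adj(2)[OF \<phi>(1) Ts(1)[OF jV] gH(2)]
        Mult_adj_V(2)[OF \<phi>(1) jV] .
  qed (intro Mult_mem \<phi> gH)+
  moreover have "(\<lambda>m. ip (\<phi> m * g) g + ip (\<phi> m * Ts g) (Ts g)) \<longlonglongrightarrow> ip g g + ip (Ts g) (Ts g)"
    by (intro tendsto_add l gH)
  ultimately have "ipB g g = 0" by (simp add: LIMSEQ_const_iff ipB_def)
  then show ?thesis using B.ip_pos[OF g(1)] by fastforce
qed

text \<open>An element \<open>g\<close> of the intersection is projected onto \<open>J\<close> in
  the graph inner product. The remainder \<open>p\<close> is orthogonal to \<open>J\<close> and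
  still lies in the H-closure of \<open>J\<close>, because \<open>g\<close> and \<open>g - p\<close>
  do; so it vanishes.\<close>

lemma closed_star_invariant_eq:
  assumes J: "cfun.subspace J" "closedin (norm_topology V B.nrm) J" "star_invariant H ip J"
  shows "J = norm_topology H nrm closure_of J \<inter> V"
proof
  have JV: "J \<subseteq> V"
    using closedin_subset[OF J(2)] Metric_space.topspace_mtopology[OF metric_V]
    by (simp add: norm_topology_def)
  then have JH: "J \<subseteq> H" using V_subset by auto
  show "J \<subseteq> norm_topology H nrm closure_of J \<inter> V"
    using closure_of_subset_self[OF JH] JV by auto
  show "norm_topology H nrm closure_of J \<inter> V \<subseteq> J"
  proof
    fix g assume "g \<in> norm_topology H nrm closure_of J \<inter> V"
    then have g: "g \<in> norm_topology H nrm closure_of J" "g \<in> V" by auto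
    obtain p where p: "p \<in> V" "g - p \<in> norm_topology V B.nrm closure_of J" "\<forall>j\<in>J. ipB j p = 0"
      using B.projection[OF J(1) JV g(2)] by blast
    have gp: "g - p \<in> J" using p(2) closure_of_closedin[OF J(2)] by simp
    then have "g - (g - p) \<in> norm_topology H nrm closure_of J"
      using closure_of_subset_self[OF JH] g(1) cfun.subspace_diff[OF closure_subspace[OF J(1) JH]]
      by blast
    then have "p = 0"
      using p JV J(3) by (intro orthogonal_in_closure_eq_0[of J p]) auto
    then show "g \<in> J" using gp by simp
  qed
qed

end

theorem theorem6p3:
  fixes u :: "'x \<Rightarrow> 'i \<Rightarrow> complex"
    and k :: "'x \<Rightarrow> 'x \<Rightarrow> complex"
    and H :: "('x \<Rightarrow> complex) set"
    and ip :: "'x cinner"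
    and h :: "'x \<Rightarrow> complex"
  assumes "cnp_space u k H ip"
    and "densely_defined_multiplier H ip h"
  shows
    "{J. closed_star_invariant_subspace H ip (HB H ip h) (HB_norm H ip h) J} =
       {K \<inter> HB H ip h | K. closed_star_invariant_subspace H ip H (ip_norm ip) K} \<and>
     (\<forall>J. closed_star_invariant_subspace H ip (HB H ip h) (HB_norm H ip h) J \<longrightarrow>
       J = (norm_topology H (ip_norm ip) closure_of J) \<inter> HB H ip h) \<and>
     (\<forall>J'. cfun.subspace J' \<and> J' \<subseteq> HB H ip h \<and> star_invariant H ip J' \<longrightarrow>
       (norm_dense H (ip_norm ip) J' \<longleftrightarrow> norm_dense (HB H ip h) (HB_norm H ip h) J') \<and>
       (norm_dense (HB H ip h) (HB_norm H ip h) J' \<longleftrightarrow>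
         is_core ip (HB H ip h) (Tstar H ip h) J'))"
proof -
  interpret cnp_multiplier H ip k u h
    using assms unfolding cnp_space_def
    by (intro cnp_multiplier.intro cnp.intro cnp_axioms.intro cnp_multiplier_axioms.intro) blast+
  note csi = closed_star_invariant_subspace_def
  have topV: "topspace (norm_topology V B.nrm) = V"
    unfolding norm_topology_def by (rule Metric_space.topspace_mtopology[OF metric_V])
  have eq: "J = norm_topology H nrm closure_of J \<inter> V"
    if "closed_star_invariant_subspace H ip V (HB_norm H ip h) J" for J
    using that unfolding csi V_norm_topology by (intro closed_star_invariant_eq) blast+
  have sub: "closed_star_invariant_subspace H ip H nrm (norm_topology H nrm closure_of J)"
    if "closed_star_invariant_subspace H ip V (HB_norm H ip h) J" for J
  proof -
    have J': "cfun.subspace J" "closedin (norm_topology V B.nrm) J" "star_invariant H ip J"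
      using that unfolding csi V_norm_topology by blast+
    then have J: "cfun.subspace J" "J \<subseteq> V" "star_invariant H ip J"
      using closedin_subset[OF J'(2)] unfolding topV by blast+
    then have JH: "J \<subseteq> H" using V_subset by auto
    show ?thesis
      unfolding csi using closure_subspace[OF J(1) JH] star_invariant_closure[OF JH J(3)] by simp
  qed
  have sup: "closed_star_invariant_subspace H ip V (HB_norm H ip h) (L \<inter> V)"
    if L: "closed_star_invariant_subspace H ip H nrm L" for L
  proof -
    have L': "cfun.subspace L" "closedin (norm_topology H nrm) L" "star_invariant H ip L"
      using L by (auto simp: csi)
    \<comment> \<open>The graph norm dominates the norm of \<open>H\<close>, so a graph limit of
      elements of \<open>L\<close> is also a limit in \<open>H\<close>.\<close>
    have "norm_topology V B.nrm closure_of (L \<inter> V) \<subseteq> norm_topology H nrm closure_of L"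
      using V_closure_subset[of "L \<inter> V"] closure_of_mono[of "L \<inter> V" L "norm_topology H nrm"] by auto
    also have "\<dots> = L" by (rule closure_of_closedin[OF L'(2)])
    finally have "norm_topology V B.nrm closure_of (L \<inter> V) \<subseteq> L \<inter> V"
      using B.closure_of_subset_carrier[of "L \<inter> V"] by auto
    then have "closedin (norm_topology V B.nrm) (L \<inter> V)"
      using closure_of_subset_eq[of "L \<inter> V" "norm_topology V B.nrm"] topV by auto
    moreover have "star_invariant H ip (L \<inter> V)"
      using L'(3) Mult_adj_V(1) by (auto simp: star_invariant_def image_subset_iff)
    moreover have "cfun.subspace (L \<inter> V)" by (rule cfun.subspace_inter[OF L'(1) V_subspace])
    ultimately show ?thesis by (simp add: csi V_norm_topology)
  qed
  have dense_iff: "norm_dense H nrm J \<longleftrightarrow> norm_dense V (HB_norm H ip h) J"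
    if J: "cfun.subspace J" "J \<subseteq> V" "star_invariant H ip J" for J
  proof
    have JH: "J \<subseteq> H" using J(2) V_subset by auto
    define C where "C = norm_topology V B.nrm closure_of J"
    assume "norm_dense H nrm J"
    then have d: "norm_topology H nrm closure_of J = H" by (simp add: norm_dense_def)
    have JC: "J \<subseteq> C" unfolding C_def by (rule B.closure_of_subset_self[OF J(2)])
    \<comment> \<open>The equality for closed subspaces is applied to the graph closure of
      \<open>J\<close>, which is again invariant. Its H-closure contains that of \<open>J\<close>,
      which is all of \<open>H\<close>.\<close>
    have "C = norm_topology H nrm closure_of C \<inter> V"
      unfolding C_def
      by (intro closed_star_invariant_eq B.closure_subspace star_invariant_V_closure J) simp
    moreover have "H \<subseteq> norm_topology H nrm closure_of C"
      using closure_of_mono[OF JC, of "norm_topology H nrm"] d by simp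
    moreover have "C \<subseteq> V" unfolding C_def by (rule B.closure_of_subset_carrier[OF J(2)])
    ultimately have "C = V" using V_subset by blast
    then show "norm_dense V (HB_norm H ip h) J"
      using J(2) by (simp add: norm_dense_def V_norm_topology C_def)
  next
    have JH: "J \<subseteq> H" using J(2) V_subset by auto
    assume "norm_dense V (HB_norm H ip h) J"
    \<comment> \<open>Graph density places \<open>V\<close> in the H-closure of \<open>J\<close>;
      the rest follows because \<open>V\<close> contains the kernel functions and so is dense in
      \<open>H\<close>.\<close>
    then have "V \<subseteq> norm_topology H nrm closure_of J"
      using V_closure_subset[OF J(2)] by (simp add: norm_dense_def V_norm_topology)
    then have "norm_topology H nrm closure_of V \<subseteq> norm_topology H nrm closure_of J"
      by (rule closure_of_minimal) simp
    then show "norm_dense H nrm J"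
      using V_dense JH closure_of_subset_carrier[OF JH] by (auto simp: norm_dense_def)
  qed
  have "{J. closed_star_invariant_subspace H ip V (HB_norm H ip h) J} =
      {L \<inter> V |L. closed_star_invariant_subspace H ip H nrm L}"
    using eq sub sup by blast
  moreover have "norm_dense V (HB_norm H ip h) J \<longleftrightarrow> is_core ip V (Tstar H ip h) J"
    if "cfun.subspace J" "J \<subseteq> V" for J
    using that by (simp add: is_core_def HB_norm_def)
  ultimately show ?thesis using eq dense_iff by blast
qed

end
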